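(* Let $2\le p\le\infty$, $\epsilon>0$, let $F\in\mathcal G_\epsilon$, and let $u_\epsilon$ be the unique $(p,\epsilon)$-Kolmogorov function in $U_X\times\mathbb R^m\times I$ with boundary values $F$. Then $$u^\epsilon_{\mathrm I}=u_\epsilon=u^\epsilon_{\mathrm{II}}\quad\text{on }U_X\times\mathbb R^m\times I,$$ where $u^\epsilon_{\mathrm I}$ and $u^\epsilon_{\mathrm{II}}$ are the values for Player I and Player II of the tug-of-war game with noise with payoff determined by $F$.
   Context: Setting. $m\ge1$; $U_X\subset\mathbb R^m$ is a bounded domain with $C^2$-smooth boundary; $0<T<\infty$, $I=(0,T)$. $B_\epsilon(X)$ is the open Euclidean ball in $\mathbb R^m$. $\alpha=1,\beta=0$ if $p=\infty$; $\alpha=\frac{p-2}{m+p}$, $\beta=\frac{m+2}{m+p}$ if $p<\infty$. Put $\Gamma_X^\epsilon=\{X\in\mathbb R^m\setminus U_X: d(X,\partial U_X)\le\epsilon\}$ ($d$ Euclidean distance), $U_X^\epsilon=U_X\cup\Gamma_X^\epsilon$, $\Gamma_\epsilon=\big(\Gamma_X^\epsilon\times\mathbb R^m\times(-\epsilon^2/2,T]\big)\cup\big(U_X\times\mathbb R^m\times(-\epsilon^2/2,0]\big)$. Class $\mathcal G_\epsilon$: functions $F:\Gamma_\epsilon\to\mathbb R$ that are bounded, such that $X\mapsto F(X,Y,t)$ is Borel measurable (on its domain) for every $(Y,t)\in\mathbb R^m\times(-\epsilon^2/2,T]$, and such that for every $t\in(-\epsilon^2/2,T]$ and $\eta>0$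 there is $\delta>0$ with $|F(X,Y_1,t)-F(X,Y_2,t)|<\eta$ whenever $|Y_1-Y_2|<\delta$ and $(X,Y_1,t),(X,Y_2,t)\in\Gamma_\epsilon$. Class $\mathcal G'_\epsilon$: functions $v:U_X^\epsilon\times\mathbb R^m\times(-\epsilon^2/2,T]\to\mathbb R$ that are bounded, such that $X\mapsto v(X,Y,t)$ is Borel measurable for every $(Y,t)$, and such that for every $t\in(-\epsilon^2/2,T]$ and $\eta>0$ there is $\delta>0$ with $|v(X,Y_1,t)-v(X,Y_2,t)|<\eta$ whenever $|Y_1-Y_2|<\delta$ and $X\in U_X^\epsilon$. A $(p,\epsilon)$-Kolmogorov function in $U_X\times\mathbb R^m\times I$ with boundary values $F\in\mathcal G_\epsilon$ is a function $u_\epsilon\in\mathcal G'_\epsilon$ with $u_\epsilon=F$ on $\Gamma_\epsilon$ and, for every $(X,Y,t)\in U_X\times\mathbb R^m\times I$, $$u_\epsilon(X,Y,t)=\tfrac\alpha2\Big\{\sup_{\tilde X\in B_\epsilon(X)}u_\epsilon(\tilde X,Y+\tfrac{\epsilon^2}{2}\tilde X,t-\tfrac{\epsilon^2}2)+\inf_{\tilde X\in B_\epsilon(X)}u_\epsilon(\tilde X,Y+\tfrac{\epsilon^2}{2}\tilde X,t-\tfrac{\epsilon^2}2)\Big\}+\frac{\beta}{|B_\epsilon(X)|}\int_{B_\epsilon(X)}u_\epsilon(\tilde X,Y+\tfrac{\epsilon^2}{2}\tilde X,t-\tfrac{\epsilon^2}2)\,d\tilde X.$$ (For each $F\in\mathcal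 G_\epsilon$ such a function exists and is unique.) The game. Fix a start $(X_0,Y_0)\in U_X\times\mathbb R^m$ and $t_0=t\in(-\epsilon^2/2,T]$; let $N=N(t)=\lceil t/(\epsilon^2/2)\rceil$ be the maximal number of rounds and $t_k=t-k\epsilon^2/2$, $k=0,\dots,N$. At state $(X_k,Y_k)$ with $X_k\in U_X$ and $k<N$: with probability $\alpha$ a fair coin is tossed and the winning player chooses $X_{k+1}\in B_\epsilon(X_k)$; with probability $\beta$, $X_{k+1}$ is chosen uniformly at random in $B_\epsilon(X_k)$; in all cases $Y_{k+1}=Y_k+\frac{\epsilon^2}2X_{k+1}$. The game ends at round $\tau$, the first $k\in\{0,\dots,N\}$ with $X_k\in\Gamma_X^\epsilon$, or $\tau=N$ if there is no such $k$. Player I then receives, and Player II pays, $F(X_\tau,Y_\tau,t_\tau)$. A strategy $S_{\mathrm I}=\{S_{\mathrm I}^k\}$ (resp. $S_{\mathrm{II}}=\{S_{\mathrm{II}}^k\}$) is a sequence of Borel measurable functions of the history $(X_0,Y_0),\dots,(X_k,Y_k)$ giving the choice $X_{k+1}\in B_\epsilon(X_k)$ when that player wins the toss. The strategies and the transition probabilities $$\Big(\tfrac\alpha2\delta_{S_{\mathrm I}^k(\text{history})}(A_X)+\tfrac\alpha2\delta_{S_{\mathrm{II}}^k(\text{history})}(A_X)+\beta\tfrac{|A_X\cap B_\epsilon(X_k)|}{|B_\epsilon(X_k)|}\Big)\quad\text{for }X_{k+1}\in A_X$$ (with $Y_{k+1}=Y_k+\frac{\epsilon^2}{2}X_{k+1}$)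 determine a probability measure on game sequences, with expectation $\mathbb E^{(X_0,Y_0),N}_{S_{\mathrm I},S_{\mathrm{II}}}$. The values are $$u^\epsilon_{\mathrm I}(X_0,Y_0,t)=\sup_{S_{\mathrm I}}\inf_{S_{\mathrm{II}}}\mathbb E^{(X_0,Y_0),N(t)}_{S_{\mathrm I},S_{\mathrm{II}}}[F(X_\tau,Y_\tau,t_\tau)],\qquad u^\epsilon_{\mathrm{II}}(X_0,Y_0,t)=\inf_{S_{\mathrm{II}}}\sup_{S_{\mathrm I}}\mathbb E^{(X_0,Y_0),N(t)}_{S_{\mathrm I},S_{\mathrm{II}}}[F(X_\tau,Y_\tau,t_\tau)].$$ *)

theory Defs
  imports "HOL-Probability.Probability"
begin

definition C2_function :: "('a::real_normed_vector \<Rightarrow> real) \<Rightarrow> bool" where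
  "C2_function g \<longleftrightarrow>
     (\<exists>(g' :: 'a \<Rightarrow> 'a \<Rightarrow>\<^sub>L real) (g'' :: 'a \<Rightarrow> 'a \<Rightarrow>\<^sub>L ('a \<Rightarrow>\<^sub>L real)).
        (\<forall>x. (g has_derivative blinfun_apply (g' x)) (at x)) \<and>
        (\<forall>x. (g' has_derivative blinfun_apply (g'' x)) (at x)) \<and>
        continuous_on UNIV g'')"

text \<open>
  Near each boundary point, the set is the epigraph of a \<open>C\<^sup>2\<close> function of the \<open>m - 1\<close>
  coordinates orthogonal to some unit vector \<open>e\<close>. To avoid a separate type for the hyperplane
  orthogonal to \<open>e\<close>, \<open>g\<close> is defined on the whole space but is only evaluated on that hyperplane.
\<close>

definition C2_boundary :: "('a::euclidean_space) set \<Rightarrow> bool" where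
  "C2_boundary U \<longleftrightarrow>
     (\<forall>x0\<in>frontier U. \<exists>r>0. \<exists>e g. norm e = 1 \<and> C2_function g \<and>
        U \<inter> ball x0 r = {x \<in> ball x0 r. x \<bullet> e > g (x - (x \<bullet> e) *\<^sub>R e)})"

definition bounded_C2_domain :: "('a::euclidean_space) set \<Rightarrow> bool" where
  "bounded_C2_domain U \<longleftrightarrow>
     U \<noteq> {} \<and> open U \<and> connected U \<and> bounded U \<and> C2_boundary U"

definition alpha_coeff :: "nat \<Rightarrow> ereal \<Rightarrow> real" where
  "alpha_coeff m p =
     (if p = \<infinity> then 1 else (real_of_ereal p - 2) / (real m + real_of_ereal p))"

definition beta_coeff :: "nat \<Rightarrow> ereal \<Rightarrow> real" where
  "beta_coeff m p =
     (if p = \<infinity> then 0 else (real m + 2) / (real m + real_of_ereal p))"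

definition GammaX :: "('a::euclidean_space) set \<Rightarrow> real \<Rightarrow> 'a set" where
  "GammaX U \<epsilon> = {X. X \<notin> U \<and> infdist X (frontier U) \<le> \<epsilon>}"

definition UX_ext :: "('a::euclidean_space) set \<Rightarrow> real \<Rightarrow> 'a set" where
  "UX_ext U \<epsilon> = U \<union> GammaX U \<epsilon>"

definition Gamma :: "('a::euclidean_space) set \<Rightarrow> real \<Rightarrow> real \<Rightarrow> ('a \<times> 'a \<times> real) set" where
  "Gamma U T \<epsilon> =
     (GammaX U \<epsilon> \<times> UNIV \<times> {- \<epsilon>\<^sup>2 / 2 <.. T}) \<union> (U \<times> UNIV \<times> {- \<epsilon>\<^sup>2 / 2 <.. 0})"

text \<open>
  Functions on a subset of \<open>\<real>\<^sup>m \<times> \<real>\<^sup>m \<times> \<real>\<close> are total functions on the whole type; their values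
  outside the subset are arbitrary and are constrained by none of the conditions below.
\<close>

definition G_class :: "('a::euclidean_space) set \<Rightarrow> real \<Rightarrow> real \<Rightarrow> ('a \<times> 'a \<times> real \<Rightarrow> real) set" where
  "G_class U T \<epsilon> = {F.
     bounded (F ` Gamma U T \<epsilon>) \<and>
     (\<forall>Y. \<forall>t \<in> {- \<epsilon>\<^sup>2 / 2 <.. T}.
        (\<lambda>X. F (X, Y, t)) \<in> borel_measurable (restrict_space borel {X. (X, Y, t) \<in> Gamma U T \<epsilon>})) \<and>
     (\<forall>t \<in> {- \<epsilon>\<^sup>2 / 2 <.. T}. \<forall>\<eta>>0. \<exists>\<delta>>0. \<forall>X Y1 Y2.
        dist Y1 Y2 < \<delta> \<and> (X, Y1, t) \<in> Gamma U T \<epsilon> \<and> (X, Y2, t) \<in> Gamma U T \<epsilon> \<longrightarrow>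
        \<bar>F (X, Y1, t) - F (X, Y2, t)\<bar> < \<eta>)}"

definition G'_class :: "('a::euclidean_space) set \<Rightarrow> real \<Rightarrow> real \<Rightarrow> ('a \<times> 'a \<times> real \<Rightarrow> real) set" where
  "G'_class U T \<epsilon> = {v.
     bounded (v ` (UX_ext U \<epsilon> \<times> UNIV \<times> {- \<epsilon>\<^sup>2 / 2 <.. T})) \<and>
     (\<forall>Y. \<forall>t \<in> {- \<epsilon>\<^sup>2 / 2 <.. T}.
        (\<lambda>X. v (X, Y, t)) \<in> borel_measurable (restrict_space borel (UX_ext U \<epsilon>))) \<and>
     (\<forall>t \<in> {- \<epsilon>\<^sup>2 / 2 <.. T}. \<forall>\<eta>>0. \<exists>\<delta>>0. \<forall>X Y1 Y2.
        dist Y1 Y2 < \<delta> \<and> X \<in> UX_ext U \<epsilon> \<longrightarrow> \<bar>v (X, Y1, t) - v (X, Y2, t)\<bar> < \<eta>)}"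

definition kolmogorov_function ::
  "('a::euclidean_space) set \<Rightarrow> real \<Rightarrow> ereal \<Rightarrow> real \<Rightarrow> ('a \<times> 'a \<times> real \<Rightarrow> real) \<Rightarrow>
   ('a \<times> 'a \<times> real \<Rightarrow> real) \<Rightarrow> bool" where
  "kolmogorov_function U T p \<epsilon> F u \<longleftrightarrow>
     u \<in> G'_class U T \<epsilon> \<and>
     (\<forall>z \<in> Gamma U T \<epsilon>. u z = F z) \<and>
     (\<forall>X\<in>U. \<forall>Y. \<forall>t\<in>{0<..<T}.
        u (X, Y, t) =
          alpha_coeff DIM('a) p / 2 *
            ((SUP X'\<in>ball X \<epsilon>. u (X', Y + (\<epsilon>\<^sup>2 / 2) *\<^sub>R X', t - \<epsilon>\<^sup>2 / 2)) +
             (INF X'\<in>ball X \<epsilon>. u (X', Y + (\<epsilon>\<^sup>2 / 2) *\<^sub>R X', t - \<epsilon>\<^sup>2 / 2))) +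
          beta_coeff DIM('a) p / measure lborel (ball X \<epsilon>) *
            (LINT X':ball X \<epsilon>|lborel. u (X', Y + (\<epsilon>\<^sup>2 / 2) *\<^sub>R X', t - \<epsilon>\<^sup>2 / 2)))"

text \<open>
  A history \<open>(X\<^sub>0, Y\<^sub>0), \<dots>, (X\<^sub>k, Y\<^sub>k)\<close> is a function on \<open>{0..<Suc k}\<close>. Strategies are also defined
  on histories that cannot occur or that have already left \<open>U\<close>; this does not affect the payoff.
\<close>

definition strategies :: "real \<Rightarrow> (nat \<Rightarrow> (nat \<Rightarrow> ('a::euclidean_space) \<times> 'a) \<Rightarrow> 'a) set" where
  "strategies \<epsilon> = {S. \<forall>k.
     S k \<in> borel_measurable (PiM {0..<Suc k} (\<lambda>_. borel)) \<and>
     (\<forall>h \<in> space (PiM {0..<Suc k} (\<lambda>_. borel)). S k h \<in> ball (fst (h k)) \<epsilon>)}"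

definition move_law :: "ereal \<Rightarrow> real \<Rightarrow> ('a::euclidean_space) \<Rightarrow> 'a \<Rightarrow> 'a \<Rightarrow> 'a measure" where
  "move_law p \<epsilon> X a b = measure_of UNIV (sets borel) (\<lambda>A.
     ennreal (alpha_coeff DIM('a) p / 2) * emeasure (return borel a) A +
     ennreal (alpha_coeff DIM('a) p / 2) * emeasure (return borel b) A +
     ennreal (beta_coeff DIM('a) p) * emeasure (uniform_measure lborel (ball X \<epsilon>)) A)"

text \<open>
  The conditional law of the state \<open>(X\<^sub>n, Y\<^sub>n)\<close> given the states \<open>0, \<dots>, n - 1\<close>; for \<open>n = 0\<close> it is
  the Dirac measure at the starting point.
\<close>

definition state_law ::
  "ereal \<Rightarrow> real \<Rightarrow> (nat \<Rightarrow> (nat \<Rightarrow> ('a::euclidean_space) \<times> 'a) \<Rightarrow> 'a) \<Rightarrow>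
   (nat \<Rightarrow> (nat \<Rightarrow> 'a \<times> 'a) \<Rightarrow> 'a) \<Rightarrow> 'a \<times> 'a \<Rightarrow> nat \<Rightarrow> (nat \<Rightarrow> 'a \<times> 'a) \<Rightarrow> ('a \<times> 'a) measure" where
  "state_law p \<epsilon> SI SII z0 n h =
     (case n of
        0 \<Rightarrow> return borel z0
      | Suc k \<Rightarrow> distr (move_law p \<epsilon> (fst (h k)) (SI k h) (SII k h)) borel
                   (\<lambda>X'. (X', snd (h k) + (\<epsilon>\<^sup>2 / 2) *\<^sub>R X')))"

text \<open>
  The law of \<open>(X\<^sub>0, Y\<^sub>0), \<dots>, (X\<^sub>N, Y\<^sub>N)\<close>, obtained by composing the kernels \<open>state_law 0, \<dots>, state_law N\<close>.
  For convenience the token keeps moving after the game has ended; the payoff below only depends on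
  the states up to the end of the game. The argument \<open>\<lambda>_. undefined\<close> is the empty history.
\<close>

definition play_law ::
  "ereal \<Rightarrow> real \<Rightarrow> (nat \<Rightarrow> (nat \<Rightarrow> ('a::euclidean_space) \<times> 'a) \<Rightarrow> 'a) \<Rightarrow>
   (nat \<Rightarrow> (nat \<Rightarrow> 'a \<times> 'a) \<Rightarrow> 'a) \<Rightarrow> 'a \<times> 'a \<Rightarrow> nat \<Rightarrow> (nat \<Rightarrow> 'a \<times> 'a) measure" where
  "play_law p \<epsilon> SI SII z0 N =
     Ionescu_Tulcea.C (state_law p \<epsilon> SI SII z0) (\<lambda>_. borel) 0 (Suc N) (\<lambda>_. undefined)"

definition max_rounds :: "real \<Rightarrow> real \<Rightarrow> nat" where
  "max_rounds \<epsilon> t = nat \<lceil>t / (\<epsilon>\<^sup>2 / 2)\<rceil>"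

definition end_round ::
  "('a::euclidean_space) set \<Rightarrow> real \<Rightarrow> nat \<Rightarrow> (nat \<Rightarrow> 'a \<times> 'a) \<Rightarrow> nat" where
  "end_round U \<epsilon> N \<omega> =
     (if \<exists>k\<le>N. fst (\<omega> k) \<in> GammaX U \<epsilon> then LEAST k. fst (\<omega> k) \<in> GammaX U \<epsilon> else N)"

text \<open>
  The indicator is 1 on every play that can occur. It is there because \<open>F\<close> is arbitrary outside
  \<open>Gamma U T \<epsilon>\<close>, possibly not even measurable.
\<close>

definition payoff ::
  "('a::euclidean_space) set \<Rightarrow> real \<Rightarrow> real \<Rightarrow> ('a \<times> 'a \<times> real \<Rightarrow> real) \<Rightarrow> real \<Rightarrow>
   (nat \<Rightarrow> 'a \<times> 'a) \<Rightarrow> real" where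
  "payoff U T \<epsilon> F t \<omega> =
     (let \<tau> = end_round U \<epsilon> (max_rounds \<epsilon> t) \<omega>;
          z = (fst (\<omega> \<tau>), snd (\<omega> \<tau>), t - real \<tau> * \<epsilon>\<^sup>2 / 2)
      in indicator (Gamma U T \<epsilon>) z * F z)"

definition expected_payoff ::
  "('a::euclidean_space) set \<Rightarrow> real \<Rightarrow> ereal \<Rightarrow> real \<Rightarrow> ('a \<times> 'a \<times> real \<Rightarrow> real) \<Rightarrow>
   'a \<Rightarrow> 'a \<Rightarrow> real \<Rightarrow> (nat \<Rightarrow> (nat \<Rightarrow> 'a \<times> 'a) \<Rightarrow> 'a) \<Rightarrow> (nat \<Rightarrow> (nat \<Rightarrow> 'a \<times> 'a) \<Rightarrow> 'a) \<Rightarrow> real" where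
  "expected_payoff U T p \<epsilon> F X Y t SI SII =
     (LINT \<omega>|play_law p \<epsilon> SI SII (X, Y) (max_rounds \<epsilon> t). payoff U T \<epsilon> F t \<omega>)"

definition value_I ::
  "('a::euclidean_space) set \<Rightarrow> real \<Rightarrow> ereal \<Rightarrow> real \<Rightarrow> ('a \<times> 'a \<times> real \<Rightarrow> real) \<Rightarrow>
   'a \<times> 'a \<times> real \<Rightarrow> real" where
  "value_I U T p \<epsilon> F = (\<lambda>(X, Y, t).
     SUP SI \<in> strategies \<epsilon>. INF SII \<in> strategies \<epsilon>. expected_payoff U T p \<epsilon> F X Y t SI SII)"

definition value_II ::
  "('a::euclidean_space) set \<Rightarrow> real \<Rightarrow> ereal \<Rightarrow> real \<Rightarrow> ('a \<times> 'a \<times> real \<Rightarrow> real) \<Rightarrow>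
   'a \<times> 'a \<times> real \<Rightarrow> real" where
  "value_II U T p \<epsilon> F = (\<lambda>(X, Y, t).
     INF SII \<in> strategies \<epsilon>. SUP SI \<in> strategies \<epsilon>. expected_payoff U T p \<epsilon> F X Y t SI SII)"

end

theory Submission
  imports Defs
begin

text \<open>
Up to a prescribed error, the first player can guarantee \<open>u\<close> against every opponent, and so can
the second; both values are then squeezed onto \<open>u\<close> (\<open>saddle_point_value\<close>).

The guaranteeing strategy of Player I is greedy: from the state \<open>(X, Y)\<close> it moves to a point
\<open>X'\<close> of the ball at which \<open>u\<close>, evaluated at the next state and the next time, is within
\<open>\<eta>\<close> of its supremum. The equation that defines a Kolmogorov function says that \<open>u\<close> is the
expected next value when both players move as well as possible, so under the greedy strategy, whatever the opponent does,
the expected value of \<open>u\<close> along the play decreases by at most \<open>\<eta>\<close> per round (\<open>one_round\<close>). When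
the game stops, \<open>u\<close> is the payoff. As there is a fixed maximal number of rounds, the total loss
is as small as desired (\<open>expected_payoff_ge\<close>). Player II is treated by applying this to \<open>- F\<close> and
\<open>- u\<close> with the players exchanged.

The delicate point is that strategies must be Borel in the history, while \<open>u\<close> is only Borel in its first
variable, so that a general near-maximizer need not be Borel. Two features of the game
help. The ball is open, so a countable set that is dense in every superlevel set
(with rational level) of the function being maximized contains near-maximizers for all centres at once. The
continuity in \<open>Y\<close> is uniform in \<open>X\<close>, so countably many values of \<open>Y\<close> suffice to produce one countable
set that works for all \<open>Y\<close> (\<open>countable_almost_maximizing_set\<close>). Choosing the first near-optimal
element of an enumeration of this set is then a Borel operation (\<open>borel_near_optimal_selection\<close>).
\<close>

section \<open>Near-optimal points chosen in a Borel way\<close>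

text \<open>
Approximating the second coordinate by simple functions reduces joint measurability to countably many
sections; continuity lets the approximations converge.
\<close>

lemma borel_measurable_Caratheodory:
  fixes f :: "'a \<Rightarrow> 'b::{metric_space, second_countable_topology} \<Rightarrow> real"
  assumes meas: "\<And>y. (\<lambda>x. f x y) \<in> borel_measurable M"
    and cont: "\<And>x. continuous_on UNIV (f x)"
  shows "(\<lambda>z. f (fst z) (snd z)) \<in> borel_measurable (M \<Otimes>\<^sub>M borel)"
proof -
  obtain q :: "nat \<Rightarrow> 'b \<Rightarrow> 'b" where q: "\<And>i. simple_function borel (q i)"
      "\<And>y. (\<lambda>i. q i y) \<longlonglongrightarrow> y"
    using borel_measurable_implies_sequence_metric[of "\<lambda>y. y" "borel :: 'b measure" undefined] by auto
  show ?thesis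
  proof (rule borel_measurable_LIMSEQ_real)
    fix z :: "'a \<times> 'b"
    have "isCont (f (fst z)) (snd z)"
      using cont[of "fst z"] by (simp add: continuous_on_eq_continuous_at)
    then show "(\<lambda>i. f (fst z) (q i (snd z))) \<longlonglongrightarrow> f (fst z) (snd z)"
      using q(2) by (rule isCont_tendsto_compose)
  next
    fix i
    have "q i \<in> borel \<rightarrow>\<^sub>M count_space (range (q i))"
      using measurable_simple_function[OF q(1)[of i]] by (auto simp: measurable_def)
    then have "(\<lambda>z. q i (snd z)) \<in> M \<Otimes>\<^sub>M borel \<rightarrow>\<^sub>M count_space (range (q i))"
      by measurable
    moreover have "countable (range (q i))"
      using q(1)[of i] by (simp add: simple_function_def countable_finite)
    ultimately show "(\<lambda>z. f (fst z) (q i (snd z))) \<in> borel_measurable (M \<Otimes>\<^sub>M borel)"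
      by (rule measurable_compose_countable'[of _ "\<lambda>y z. f (fst z) y",
            OF measurable_compose[OF measurable_fst meas]])
  qed
qed

text \<open>
For a single function \<open>g\<close>, take a countable dense subset of every superlevel set \<open>{g > a}\<close> with \<open>a\<close>
rational: an open set that meets \<open>{g > a}\<close> meets that subset. No regularity of \<open>g\<close> is involved.
Equicontinuity in \<open>y\<close> transfers the property from a countable dense set of parameters to all of them.
\<close>

lemma countable_almost_maximizing_set:
  fixes G :: "'a::euclidean_space \<Rightarrow> 'b::{metric_space, second_countable_topology} \<Rightarrow> real"
  assumes equicont: "\<And>\<eta>. \<eta> > 0 \<Longrightarrow> \<exists>\<delta>>0. \<forall>x y1 y2. dist y1 y2 < \<delta> \<longrightarrow> \<bar>G x y1 - G x y2\<bar> < \<eta>"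
    and "\<eta> > 0"
  obtains D where "countable D"
    "\<And>V x y. open V \<Longrightarrow> x \<in> V \<Longrightarrow> \<exists>d\<in>D \<inter> V. G x y \<le> G d y + \<eta>"
proof -
  obtain Q :: "'b set" where Q: "countable Q" "\<And>V. open V \<Longrightarrow> V \<noteq> {} \<Longrightarrow> \<exists>d\<in>Q. d \<in> V"
    by (rule countable_dense_setE) blast
  have "\<exists>E. countable E \<and> E \<subseteq> {x. G x q > a} \<and> {x. G x q > a} \<subseteq> closure E" for q and a :: real
    by (rule separable[of "{x. G x q > a}"]) blast
  then have "\<forall>q. \<exists>E'. \<forall>a. countable (E' a) \<and> E' a \<subseteq> {x. G x q > a} \<and> {x. G x q > a} \<subseteq> closure (E' a)"
    by (intro allI choice) blast
  then obtain E where "\<forall>q a. countable (E q a) \<and> E q a \<subseteq> {x. G x q > a} \<and> {x. G x q > a} \<subseteq> closure (E q a)"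
    by (rule choice[THEN exE])
  then have E: "countable (E q a)" "E q a \<subseteq> {x. G x q > a}" "{x. G x q > a} \<subseteq> closure (E q a)" for q a
    by simp_all
  define D where "D = (\<Union>q\<in>Q. \<Union>a\<in>\<rat>. E q a)"
  show thesis
  proof
    show "countable D"
      unfolding D_def using Q(1) E(1) countable_rat by (intro countable_UN) auto
    fix V :: "'a set" and x y assume V: "open V" "x \<in> V"
    obtain \<delta> where \<delta>: "\<delta> > 0" "\<And>x y1 y2. dist y1 y2 < \<delta> \<Longrightarrow> \<bar>G x y1 - G x y2\<bar> < \<eta> / 3"
      using equicont[of "\<eta> / 3"] \<open>\<eta> > 0\<close> by auto
    obtain q where q: "q \<in> Q" "dist y q < \<delta>"
      using Q(2)[of "ball y \<delta>"] \<open>\<delta> > 0\<close> by auto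
    \<comment> \<open>Each third of \<open>\<eta>\<close> pays for one step: \<open>y\<close> to \<open>q\<close> at \<open>x\<close>, the gap below \<open>G x q\<close>, and \<open>q\<close> back to \<open>y\<close> at \<open>d\<close>.\<close>
    obtain a where a: "a \<in> \<rat>" "G x q - \<eta> / 3 < a" "a < G x q"
      using Rats_dense_in_real[of "G x q - \<eta> / 3" "G x q"] \<open>\<eta> > 0\<close> by auto
    have "x \<in> closure (E q a)"
      using E(3) a(3) by auto
    then obtain d where d: "d \<in> E q a" "d \<in> V"
      using V by (auto simp: closure_iff_nhds_not_empty)
    then have "d \<in> D"
      using q(1) a(1) by (auto simp: D_def)
    have "G d q > a"
      using d(1) E(2) by auto
    then have "G x y \<le> G d y + \<eta>"
      using \<delta>(2)[OF q(2), of x] \<delta>(2)[OF q(2), of d] a by linarith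
    with \<open>d \<in> D\<close> \<open>d \<in> V\<close> show "\<exists>d\<in>D \<inter> V. G x y \<le> G d y + \<eta>"
      by blast
  qed
qed

text \<open>
The first element of a countable almost maximizing set that lies in the ball and is, within the ball, almost
optimal among the elements of that set. Comparing with these countably many elements only, instead of with the
supremum over the ball, makes the defining condition Borel.
\<close>

lemma borel_near_optimal_selection:
  fixes G :: "'a::euclidean_space \<Rightarrow> 'b::{metric_space, second_countable_topology} \<Rightarrow> real"
  assumes equicont: "\<And>\<eta>. \<eta> > 0 \<Longrightarrow> \<exists>\<delta>>0. \<forall>x y1 y2. dist y1 y2 < \<delta> \<longrightarrow> \<bar>G x y1 - G x y2\<bar> < \<eta>"
    and bounded: "\<And>x y. \<bar>G x y\<bar> \<le> B"
    and "\<epsilon> > 0" "\<eta> > 0"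
  obtains s where "s \<in> borel_measurable (borel \<Otimes>\<^sub>M borel)"
    "\<And>x y. s (x, y) \<in> ball x \<epsilon>"
    "\<And>x y x'. x' \<in> ball x \<epsilon> \<Longrightarrow> G x' y \<le> G (s (x, y)) y + \<eta>"
proof -
  obtain D where D: "countable D"
      "\<And>V x y. open V \<Longrightarrow> x \<in> V \<Longrightarrow> \<exists>d\<in>D \<inter> V. G x y \<le> G d y + \<eta> / 2"
    by (rule countable_almost_maximizing_set[OF equicont half_gt_zero[OF \<open>\<eta> > 0\<close>]]) auto
  have "D \<noteq> {}"
    using D(2)[of UNIV] by auto
  define d where "d = from_nat_into D"
  have d: "\<exists>n. d n \<in> V \<and> G x y \<le> G (d n) y + \<eta> / 2" if "open V" "x \<in> V" for V x y
    using D(2)[OF that, of y] from_nat_into_surj[OF D(1)] unfolding d_def by blast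
  have contG: "continuous_on UNIV (G x)" for x
    unfolding continuous_on_iff
  proof (intro ballI allI impI)
    fix y and e :: real assume "e > 0"
    from equicont[OF this] obtain \<delta> where "\<delta> > 0" "\<forall>x y1 y2. dist y1 y2 < \<delta> \<longrightarrow> \<bar>G x y1 - G x y2\<bar> < e"
      by blast
    then show "\<exists>d>0. \<forall>x'\<in>UNIV. dist x' y < d \<longrightarrow> dist (G x x') (G x y) < e"
      by (auto simp: dist_real_def)
  qed
  have [measurable]: "G x \<in> borel_measurable borel" for x
    using contG by (rule borel_measurable_continuous_onI)
  define P where "P n z \<longleftrightarrow> d n \<in> ball (fst z) \<epsilon> \<and>
      (\<forall>m. d m \<in> ball (fst z) \<epsilon> \<longrightarrow> G (d m) (snd z) \<le> G (d n) (snd z) + \<eta> / 2)" for n z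
  have P_meas: "Measurable.pred (borel \<Otimes>\<^sub>M borel) (P n)" for n
    unfolding P_def mem_ball by measurable
  have ex: "\<exists>n. P n (x, y)" for x y
  proof -
    define A where "A = (\<lambda>n. G (d n) y) ` {n. d n \<in> ball x \<epsilon>}"
    obtain k where "d k \<in> ball x \<epsilon>"
      using d[of "ball x \<epsilon>" x y] \<open>\<epsilon> > 0\<close> by auto
    then have "A \<noteq> {}"
      unfolding A_def by blast
    have "bdd_above A"
      unfolding A_def by (rule bdd_aboveI2[of _ _ B]) (rule abs_le_D1[OF bounded])
    note A = \<open>A \<noteq> {}\<close> \<open>bdd_above A\<close>
    obtain v where "v \<in> A" "Sup A - \<eta> / 2 < v"
      using less_cSupD[OF A(1), of "Sup A - \<eta> / 2"] \<open>\<eta> > 0\<close> by auto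
    then obtain n where n: "d n \<in> ball x \<epsilon>" "Sup A - \<eta> / 2 < G (d n) y"
      by (auto simp: A_def)
    have "G (d m) y \<le> G (d n) y + \<eta> / 2" if "d m \<in> ball x \<epsilon>" for m
      using cSup_upper[of "G (d m) y" A] A(2) n(2) that by (auto simp: A_def)
    with n show ?thesis
      by (auto simp: P_def)
  qed
  define N where "N z = (LEAST n. P n z)" for z
  have N: "P (N (x, y)) (x, y)" for x y
    unfolding N_def using LeastI_ex[OF ex] .
  show thesis
  proof
    have "N \<in> borel \<Otimes>\<^sub>M borel \<rightarrow>\<^sub>M count_space UNIV"
      unfolding N_def by (intro measurable_Least P_meas)
    then show "(\<lambda>z. d (N z)) \<in> borel_measurable (borel \<Otimes>\<^sub>M borel)"
      by (rule measurable_compose) simp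
    show "d (N (x, y)) \<in> ball x \<epsilon>" for x y
      using N[of x y] by (simp add: P_def)
    fix x x' :: 'a and y :: 'b assume "x' \<in> ball x \<epsilon>"
    then obtain m where "d m \<in> ball x \<epsilon>" "G x' y \<le> G (d m) y + \<eta> / 2"
      using d[of "ball x \<epsilon>" x' y] by auto
    then show "G x' y \<le> G (d (N (x, y))) y + \<eta>"
      using N[of x y] unfolding P_def by force
  qed
qed

section \<open>The law of one move\<close>

lemma coeffs_convex:
  assumes "2 \<le> p"
  shows "alpha_coeff m p \<ge> 0" "beta_coeff m p \<ge> 0" "alpha_coeff m p + beta_coeff m p = 1"
proof -
  have "alpha_coeff m p \<ge> 0 \<and> beta_coeff m p \<ge> 0 \<and> alpha_coeff m p + beta_coeff m p = 1"
  proof (cases p)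
    case (real r)
    then have "r \<ge> 2" using assms by simp
    with real show ?thesis
      by (simp add: alpha_coeff_def beta_coeff_def add_divide_distrib[symmetric])
  qed (use assms in \<open>auto simp: alpha_coeff_def beta_coeff_def\<close>)
  then show "alpha_coeff m p \<ge> 0" "beta_coeff m p \<ge> 0" "alpha_coeff m p + beta_coeff m p = 1"
    by auto
qed

lemma sets_move_law [measurable_cong, simp]: "sets (move_law p \<epsilon> X a b) = sets borel"
  by (simp add: move_law_def sets.sigma_sets_eq[of borel, simplified])

lemma space_move_law [simp]: "space (move_law p \<epsilon> X a b) = UNIV"
  by (simp add: move_law_def space_measure_of_conv)

text \<open>
\<open>measure_of\<close> returns the prescribed set function only if it is a measure; a nonnegative combination of measures
is one.
\<close>

lemma emeasure_move_law:
  fixes X :: "'a::euclidean_space"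
  assumes "A \<in> sets borel"
  shows "emeasure (move_law p \<epsilon> X a b) A =
     ennreal (alpha_coeff DIM('a) p / 2) * emeasure (return borel a) A +
     ennreal (alpha_coeff DIM('a) p / 2) * emeasure (return borel b) A +
     ennreal (beta_coeff DIM('a) p) * emeasure (uniform_measure lborel (ball X \<epsilon>)) A"
  unfolding move_law_def
proof (rule emeasure_measure_of_sigma[OF _ _ _ assms])
  show "sigma_algebra UNIV (sets (borel :: 'a measure))"
    using sets.sigma_algebra_axioms[of borel] by simp
  show "positive (sets borel) (\<lambda>A. ennreal (alpha_coeff DIM('a) p / 2) * emeasure (return borel a) A +
     ennreal (alpha_coeff DIM('a) p / 2) * emeasure (return borel b) A +
     ennreal (beta_coeff DIM('a) p) * emeasure (uniform_measure lborel (ball X \<epsilon>)) A)"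
    by (simp add: positive_def)
  have sum: "(\<Sum>i. emeasure M (A i)) = emeasure M (\<Union>i. A i)"
    if "range A \<subseteq> sets borel" "disjoint_family A" "sets M = sets borel" for M :: "'a measure" and A :: "nat \<Rightarrow> 'a set"
    using that by (intro suminf_emeasure) auto
  show "countably_additive (sets borel) (\<lambda>A. ennreal (alpha_coeff DIM('a) p / 2) * emeasure (return borel a) A +
     ennreal (alpha_coeff DIM('a) p / 2) * emeasure (return borel b) A +
     ennreal (beta_coeff DIM('a) p) * emeasure (uniform_measure lborel (ball X \<epsilon>)) A)"
  proof (rule countably_additiveI)
    fix A :: "nat \<Rightarrow> 'a set" assume A: "range A \<subseteq> sets borel" "disjoint_family A"
    show "(\<Sum>i. ennreal (alpha_coeff DIM('a) p / 2) * emeasure (return borel a) (A i) +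
         ennreal (alpha_coeff DIM('a) p / 2) * emeasure (return borel b) (A i) +
         ennreal (beta_coeff DIM('a) p) * emeasure (uniform_measure lborel (ball X \<epsilon>)) (A i)) =
       ennreal (alpha_coeff DIM('a) p / 2) * emeasure (return borel a) (\<Union> (range A)) +
         ennreal (alpha_coeff DIM('a) p / 2) * emeasure (return borel b) (\<Union> (range A)) +
         ennreal (beta_coeff DIM('a) p) * emeasure (uniform_measure lborel (ball X \<epsilon>)) (\<Union> (range A))"
      by (simp only: suminf_add[symmetric] summableI ennreal_suminf_cmult sum[OF A] sets_return
          sets_uniform_measure sets_lborel)
  qed
qed

lemma move_law_commute: "move_law p \<epsilon> X a b = move_law p \<epsilon> X b a"
  by (simp add: move_law_def add.commute)

lemma nn_integral_move_law:
  fixes X :: "'a::euclidean_space"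
  assumes "f \<in> borel_measurable borel"
  shows "(\<integral>\<^sup>+x. f x \<partial>move_law p \<epsilon> X a b) =
     ennreal (alpha_coeff DIM('a) p / 2) * f a + ennreal (alpha_coeff DIM('a) p / 2) * f b +
     ennreal (beta_coeff DIM('a) p) * (\<integral>\<^sup>+x. f x \<partial>uniform_measure lborel (ball X \<epsilon>))"
proof -
  let ?c = "ennreal (alpha_coeff DIM('a) p / 2)" and ?d = "ennreal (beta_coeff DIM('a) p)"
  let ?U = "uniform_measure lborel (ball X \<epsilon>)"
  have "(\<integral>\<^sup>+x. f x \<partial>move_law p \<epsilon> X a b) = ?c * (\<integral>\<^sup>+x. f x \<partial>return borel a) +
      ?c * (\<integral>\<^sup>+x. f x \<partial>return borel b) + ?d * (\<integral>\<^sup>+x. f x \<partial>?U)"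
    using assms
  proof (induction rule: borel_measurable_induct)
    case (cong f g)
    then show ?case by (simp cong: nn_integral_cong)
  next
    case (set A)
    then have "A \<in> sets (move_law p \<epsilon> X a b)" "A \<in> sets (return borel a)"
      "A \<in> sets (return borel b)" "A \<in> sets ?U" by simp_all
    then show ?case by (simp only: nn_integral_indicator emeasure_move_law[OF set])
  next
    case (mult u c)
    then show ?case
      by (simp add: nn_integral_cmult distrib_left mult.left_commute del: nn_integral_return)
  next
    case (add u v)
    then show ?case
      by (simp add: nn_integral_add distrib_left add_ac del: nn_integral_return)
  next
    case (seq V)
    let ?I = "\<lambda>M i. \<integral>\<^sup>+x. V i x \<partial>M"
    have V [measurable]: "V i \<in> borel_measurable borel" for i by (rule seq.hyps)
    have conv: "(\<integral>\<^sup>+x. (SUP i. V i x) \<partial>M) = (SUP i. ?I M i)" if "sets M = sets borel" for M :: "'a measure"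
      by (rule nn_integral_monotone_convergence_SUP[OF seq.hyps(3)])
        (simp add: measurable_cong_sets[OF that refl])
    have inc: "incseq (\<lambda>i. c * ?I M i)" for M c
      using seq.hyps(3) by (auto simp: incseq_def le_fun_def intro!: mult_left_mono nn_integral_mono)
    have inc_add: "incseq (\<lambda>i. c * ?I M i + d * ?I M' i)" for M M' c d
      using inc[of c M] inc[of d M'] by (auto simp: incseq_def intro!: add_mono)
    show ?case
      by (simp add: image_image conv seq.IH SUP_mult_left_ennreal ennreal_SUP_add inc inc_add del: nn_integral_return)
  qed
  then show ?thesis
    using assms by (simp add: nn_integral_return)
qed

lemma prob_space_uniform_ball:
  fixes X :: "'a::euclidean_space"
  assumes "\<epsilon> > 0"
  shows "prob_space (uniform_measure lborel (ball X \<epsilon>))"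
  using assms content_ball_pos[of \<epsilon> X] emeasure_lborel_ball_finite[of X \<epsilon>]
  by (intro prob_space_uniform_measure) (auto simp: measure_def)

lemma prob_space_move_law:
  fixes X :: "'a::euclidean_space"
  assumes "2 \<le> p" "\<epsilon> > 0"
  shows "prob_space (move_law p \<epsilon> X a b)"
proof
  interpret U: prob_space "uniform_measure lborel (ball X \<epsilon>)"
    by (rule prob_space_uniform_ball[OF assms(2)])
  have "emeasure (move_law p \<epsilon> X a b) UNIV = ennreal (alpha_coeff DIM('a) p / 2) +
     ennreal (alpha_coeff DIM('a) p / 2) + ennreal (beta_coeff DIM('a) p)"
    using U.emeasure_space_1 by (simp add: emeasure_move_law del: emeasure_uniform_measure)
  also have "\<dots> = 1"
    using coeffs_convex[OF assms(1), of "DIM('a)"] by (simp add: ennreal_plus[symmetric] del: ennreal_plus)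
  finally show "emeasure (move_law p \<epsilon> X a b) (space (move_law p \<epsilon> X a b)) = 1"
    by simp
qed

lemma integral_uniform_ball:
  fixes X :: "'a::euclidean_space" and g :: "'a \<Rightarrow> real"
  assumes [measurable]: "g \<in> borel_measurable borel" and "\<epsilon> > 0"
  shows "(LINT x|uniform_measure lborel (ball X \<epsilon>). g x) =
    (LINT x:ball X \<epsilon>|lborel. g x) / measure lborel (ball X \<epsilon>)"
proof -
  have fin: "emeasure lborel (ball X \<epsilon>) = ennreal (measure lborel (ball X \<epsilon>))"
    using emeasure_lborel_ball_finite[of X \<epsilon>] by (intro emeasure_eq_ennreal_measure) auto
  have pos: "measure lborel (ball X \<epsilon>) > 0"
    using \<open>\<epsilon> > 0\<close> by (simp add: content_ball_pos)
  have density_meas: "(\<lambda>x. indicator (ball X \<epsilon>) x / measure lborel (ball X \<epsilon>)) \<in> borel_measurable lborel"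
    by (intro borel_measurable_divide borel_measurable_indicator borel_measurable_const) simp
  have "uniform_measure lborel (ball X \<epsilon>) =
      density lborel (\<lambda>x. ennreal (indicator (ball X \<epsilon>) x / measure lborel (ball X \<epsilon>)))"
    unfolding uniform_measure_def
  proof (rule density_cong)
    show "AE x in lborel. indicator (ball X \<epsilon>) x / emeasure lborel (ball X \<epsilon>) =
        ennreal (indicator (ball X \<epsilon>) x / measure lborel (ball X \<epsilon>))"
      unfolding fin using pos
      by (intro AE_I2) (auto simp: divide_ennreal simp flip: ennreal_1 split: split_indicator)
    show "(\<lambda>x. indicator (ball X \<epsilon>) x / emeasure lborel (ball X \<epsilon>)) \<in> borel_measurable lborel"
      by (intro borel_measurable_divide_ennreal borel_measurable_indicator borel_measurable_const) simp
    show "(\<lambda>x. ennreal (indicator (ball X \<epsilon>) x / measure lborel (ball X \<epsilon>))) \<in> borel_measurable lborel"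
      by (rule measurable_compose[OF density_meas measurable_ennreal])
  qed
  then have "(LINT x|uniform_measure lborel (ball X \<epsilon>). g x) =
      (LINT x|lborel. (indicator (ball X \<epsilon>) x / measure lborel (ball X \<epsilon>)) *\<^sub>R g x)"
    using pos by (simp only:) (rule integral_density[OF _ density_meas], auto)
  then show ?thesis
    by (simp add: set_lebesgue_integral_def)
qed

text \<open>
This is the right-hand side of the Kolmogorov equation with the supremum and the infimum replaced by the values
at the points that the two players choose.
\<close>

lemma integral_move_law:
  fixes X :: "'a::euclidean_space" and g :: "'a \<Rightarrow> real"
  assumes p: "2 \<le> p" and "\<epsilon> > 0"
    and [measurable]: "g \<in> borel_measurable borel" and bounded: "\<And>x. \<bar>g x\<bar> \<le> B"
  shows "(LINT x|move_law p \<epsilon> X a b. g x) =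
     alpha_coeff DIM('a) p / 2 * (g a + g b) +
     beta_coeff DIM('a) p / measure lborel (ball X \<epsilon>) * (LINT x:ball X \<epsilon>|lborel. g x)"
proof -
  let ?c = "alpha_coeff DIM('a) p / 2" and ?d = "beta_coeff DIM('a) p"
  let ?M = "move_law p \<epsilon> X a b" and ?U = "uniform_measure lborel (ball X \<epsilon>)"
  interpret M: prob_space ?M
    using p \<open>\<epsilon> > 0\<close> by (rule prob_space_move_law)
  interpret U: prob_space ?U
    using \<open>\<epsilon> > 0\<close> by (rule prob_space_uniform_ball)
  have int: "integrable ?M g" "integrable ?U g"
    using bounded by (auto intro!: M.integrable_const_bound[of _ B] U.integrable_const_bound[of _ B])
  \<comment> \<open>Adding \<open>B\<close> makes the integrand nonnegative; it cancels since the three weights sum to 1.\<close>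
  define f where "f x = g x + B" for x
  have f0: "f x \<ge> 0" for x
    using bounded[of x] by (simp add: f_def)
  have intf: "integrable ?M f" "integrable ?U f"
    unfolding f_def using int by simp_all
  have Mf: "(LINT x|?M. f x) = (LINT x|?M. g x) + B" and Uf: "(LINT x|?U. f x) = (LINT x|?U. g x) + B"
    using int M.prob_space U.prob_space by (auto simp: f_def)
  have "ennreal (LINT x|?M. f x) = (\<integral>\<^sup>+x. ennreal (f x) \<partial>?M)"
    using intf(1) f0 by (simp add: nn_integral_eq_integral)
  also have "\<dots> = ennreal ?c * ennreal (f a) + ennreal ?c * ennreal (f b) + ennreal ?d * (\<integral>\<^sup>+x. ennreal (f x) \<partial>?U)"
    by (rule nn_integral_move_law) (simp add: f_def)
  also have "\<dots> = ennreal ?c * ennreal (f a) + ennreal ?c * ennreal (f b) + ennreal ?d * ennreal (LINT x|?U. f x)"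
    using intf(2) f0 by (simp add: nn_integral_eq_integral)
  also have "\<dots> = ennreal (?c * f a + ?c * f b + ?d * (LINT x|?U. f x))"
    using coeffs_convex[OF p, of "DIM('a)"] f0
    by (simp add: ennreal_mult[symmetric] ennreal_plus[symmetric] del: ennreal_plus)
  finally have "(LINT x|?M. f x) = ?c * f a + ?c * f b + ?d * (LINT x|?U. f x)"
    using coeffs_convex[OF p, of "DIM('a)"] f0 by (subst (asm) ennreal_inj) (auto intro!: integral_nonneg_AE add_nonneg_nonneg mult_nonneg_nonneg)
  then have "(LINT x|?M. g x) + B = ?c * (g a + B) + ?c * (g b + B) + ?d * ((LINT x|?U. g x) + B)"
    unfolding Mf Uf by (simp add: f_def)
  moreover have "?d = 1 - 2 * ?c"
    using coeffs_convex[OF p, of "DIM('a)"] by simp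
  moreover have "I = c * (x + y) + d * v"
    if "I + B = c * (x + B) + c * (y + B) + d * (v + B)" "d = 1 - 2 * c" for I c d x y v
    using that(1) unfolding that(2) by (simp add: algebra_simps)
  ultimately have "(LINT x|?M. g x) = ?c * (g a + g b) + ?d * (LINT x|?U. g x)"
    by blast
  then show ?thesis
    by (simp add: integral_uniform_ball[OF _ \<open>\<epsilon> > 0\<close>])
qed

lemma AE_move_law_ball:
  fixes X :: "'a::euclidean_space"
  assumes "a \<in> ball X \<epsilon>" "b \<in> ball X \<epsilon>"
  shows "AE x in move_law p \<epsilon> X a b. x \<in> ball X \<epsilon>"
proof (rule AE_I')
  show "UNIV - ball X \<epsilon> \<in> null_sets (move_law p \<epsilon> X a b)"
    using assms by (auto simp: null_sets_def emeasure_move_law)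
qed auto

text \<open>
Only the uniform part needs an argument: the volume of \<open>A \<inter> ball x \<epsilon>\<close> is a Borel function of \<open>x\<close> by
Tonelli's theorem, and the volume of the ball does not depend on its centre.
\<close>

lemma measurable_move_law:
  fixes a b X :: "'c \<Rightarrow> 'a::euclidean_space"
  assumes p: "2 \<le> p" and "\<epsilon> > 0"
    and [measurable]: "X \<in> borel_measurable M" "a \<in> borel_measurable M" "b \<in> borel_measurable M"
  shows "(\<lambda>h. move_law p \<epsilon> (X h) (a h) (b h)) \<in> M \<rightarrow>\<^sub>M subprob_algebra borel"
proof (rule measurable_subprob_algebra)
  show "subprob_space (move_law p \<epsilon> (X h) (a h) (b h))" for h
    using prob_space_move_law[OF p \<open>\<epsilon> > 0\<close>] by (rule prob_space_imp_subprob_space)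
  fix A :: "'a set" assume A [measurable]: "A \<in> sets borel"
  have "emeasure lborel (ball x \<epsilon> \<inter> A) = (\<integral>\<^sup>+y. indicator {z. dist (fst z) (snd z) < \<epsilon>} (x, y) * indicator A y \<partial>lborel)" for x :: 'a
    by (subst nn_integral_indicator[symmetric])
       (auto intro!: nn_integral_cong simp del: nn_integral_indicator split: split_indicator)
  moreover have ball0: "emeasure lborel (ball x \<epsilon>) = emeasure lborel (ball (0::'a) \<epsilon>)" for x :: 'a
    using \<open>\<epsilon> > 0\<close> by (simp add: emeasure_ball)
  ultimately have "emeasure (move_law p \<epsilon> (X h) (a h) (b h)) A =
      ennreal (alpha_coeff DIM('a) p / 2) * indicator A (a h) +
      ennreal (alpha_coeff DIM('a) p / 2) * indicator A (b h) +
      ennreal (beta_coeff DIM('a) p) *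
       ((\<integral>\<^sup>+y. indicator {z. dist (fst z) (snd z) < \<epsilon>} (X h, y) * indicator A y \<partial>lborel) / emeasure lborel (ball (0::'a) \<epsilon>))" for h
    by (simp add: emeasure_move_law ball0[of "X h"])
  moreover have "{z :: 'a \<times> 'a. dist (fst z) (snd z) < \<epsilon>} \<in> sets (borel \<Otimes>\<^sub>M borel)"
    unfolding borel_prod by (intro borel_open open_Collect_less continuous_intros)
  note this [measurable]
  ultimately show "(\<lambda>h. emeasure (move_law p \<epsilon> (X h) (a h) (b h)) A) \<in> borel_measurable M"
    by simp
qed simp

lemma measurable_state_law:
  fixes z0 :: "'a::euclidean_space \<times> 'a"
  assumes p: "2 \<le> p" and "\<epsilon> > 0" and S: "SI \<in> strategies \<epsilon>" "SII \<in> strategies \<epsilon>"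
  shows "state_law p \<epsilon> SI SII z0 n \<in> PiM {0..<n} (\<lambda>_. borel) \<rightarrow>\<^sub>M subprob_algebra borel"
proof (cases n)
  case 0
  show ?thesis
    unfolding 0 state_law_def nat.case
    by (intro measurable_const) (simp add: space_subprob_algebra prob_space_imp_subprob_space prob_space_return)
next
  case (Suc k)
  let ?H = "PiM {0..<Suc k} (\<lambda>_. borel :: ('a \<times> 'a) measure)"
  have last [measurable]: "(\<lambda>h. h k) \<in> ?H \<rightarrow>\<^sub>M borel \<Otimes>\<^sub>M borel"
    unfolding borel_prod by (rule measurable_component_singleton) simp
  have S_meas: "SI k \<in> borel_measurable ?H" "SII k \<in> borel_measurable ?H"
    using S by (auto simp: strategies_def)
  show ?thesis
    unfolding Suc state_law_def nat.case
  proof (rule measurable_distr2[of _ _ borel])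
    show "(\<lambda>(h, x). (x, snd (h k) + (\<epsilon>\<^sup>2 / 2) *\<^sub>R x))
      \<in> Pi\<^sub>M {0..<Suc k} (\<lambda>_. borel :: ('a \<times> 'a) measure) \<Otimes>\<^sub>M borel \<rightarrow>\<^sub>M borel"
      unfolding borel_prod[symmetric] by measurable
    show "(\<lambda>h. move_law p \<epsilon> (fst (h k)) (SI k h) (SII k h)) \<in> Pi\<^sub>M {0..<Suc k} (\<lambda>_. borel) \<rightarrow>\<^sub>M subprob_algebra borel"
      using p \<open>\<epsilon> > 0\<close> measurable_compose[OF last measurable_fst] S_meas by (rule measurable_move_law)
  qed
qed

lemma Ionescu_Tulcea_state_law:
  fixes z0 :: "'a::euclidean_space \<times> 'a"
  assumes p: "2 \<le> p" and "\<epsilon> > 0" and S: "SI \<in> strategies \<epsilon>" "SII \<in> strategies \<epsilon>"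
  shows "Ionescu_Tulcea (state_law p \<epsilon> SI SII z0) (\<lambda>_. borel)"
proof (rule Ionescu_Tulcea.intro)
  show "prob_space (state_law p \<epsilon> SI SII z0 n h)" if "h \<in> space (PiM {0..<n} (\<lambda>_. borel))" for n and h :: "nat \<Rightarrow> 'a \<times> 'a"
  proof (cases n)
    case 0
    then show ?thesis
      by (simp add: state_law_def prob_space_return)
  next
    case (Suc k)
    have "(\<lambda>x. (x, snd (h k) + (\<epsilon>\<^sup>2 / 2) *\<^sub>R x)) \<in> borel_measurable borel"
      unfolding borel_prod[symmetric] by measurable
    then show ?thesis
      unfolding Suc state_law_def nat.case
      by (intro prob_space.prob_space_distr prob_space_move_law p \<open>\<epsilon> > 0\<close>) simp
  qed
qed (rule measurable_state_law[OF assms])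

lemma (in prob_space) abs_expectation_le:
  fixes f :: "'a \<Rightarrow> real"
  assumes "f \<in> borel_measurable M" and bounded: "\<And>x. x \<in> space M \<Longrightarrow> \<bar>f x\<bar> \<le> B"
  shows "\<bar>expectation f\<bar> \<le> B"
proof -
  have "integrable M f"
    using assms by (intro integrable_const_bound[of _ B]) auto
  then show ?thesis
    using bounded by (auto simp: abs_le_iff minus_le_iff intro!: integral_le_const integral_ge_const)
qed

section \<open>Geometry of the domain and the end of the game\<close>

text \<open>
A segment from \<open>X\<close> to a point outside \<open>U\<close> crosses the boundary, so a legal move lands in \<open>U\<close> or
in the boundary strip \<open>GammaX U \<epsilon>\<close>.
\<close>

lemma ball_subset_UX_ext:
  fixes U :: "'a::euclidean_space set"
  assumes "X \<in> U"
  shows "ball X \<epsilon> \<subseteq> UX_ext U \<epsilon>"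
proof
  fix x assume x: "x \<in> ball X \<epsilon>"
  show "x \<in> UX_ext U \<epsilon>"
  proof (cases "x \<in> U")
    case False
    have "closed_segment X x \<inter> frontier U \<noteq> {}"
      using assms False by (intro connected_Int_frontier) auto
    then obtain y where y: "y \<in> closed_segment X x" "y \<in> frontier U"
      by blast
    have "infdist x (frontier U) \<le> dist x y"
      using y(2) by (rule infdist_le)
    also have "\<dots> \<le> dist X x"
      using segment_bound(2)[OF y(1)] by (simp add: dist_norm norm_minus_commute)
    also have "\<dots> \<le> \<epsilon>"
      using x by simp
    finally show ?thesis
      using False by (simp add: UX_ext_def GammaX_def)
  qed (simp add: UX_ext_def)
qed

lemma closed_GammaX:
  assumes "open U"
  shows "closed (GammaX U \<epsilon>)"
proof -
  have "GammaX U \<epsilon> = (- U) \<inter> {X. infdist X (frontier U) \<le> \<epsilon>}"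
    by (auto simp: GammaX_def)
  moreover have "closed {X. infdist X (frontier U) \<le> \<epsilon>}"
    by (intro closed_Collect_le continuous_intros)
  ultimately show ?thesis
    using assms by (simp add: closed_Int closed_Compl)
qed

text \<open>
In this form the end round is manifestly a stopping time: whether it is at most \<open>j\<close> with \<open>j < k\<close> depends
on the states \<open>0, \<dots>, j\<close> alone.
\<close>

lemma end_round_eq_Least:
  "end_round U \<epsilon> k h = (LEAST j. k \<le> j \<or> fst (h j) \<in> GammaX U \<epsilon>)"
proof (cases "\<exists>j\<le>k. fst (h j) \<in> GammaX U \<epsilon>")
  case True
  then obtain j where j: "j \<le> k" "fst (h j) \<in> GammaX U \<epsilon>" by blast
  define l where "l = (LEAST j. fst (h j) \<in> GammaX U \<epsilon>)"
  have l: "fst (h l) \<in> GammaX U \<epsilon>" "l \<le> j"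
    unfolding l_def using j(2) by (rule LeastI, rule Least_le)
  have "(LEAST j. k \<le> j \<or> fst (h j) \<in> GammaX U \<epsilon>) = l"
  proof (rule Least_equality)
    fix i assume "k \<le> i \<or> fst (h i) \<in> GammaX U \<epsilon>"
    then show "l \<le> i"
      using l(2) j(1) Least_le[of "\<lambda>j. fst (h j) \<in> GammaX U \<epsilon>" i] by (auto simp: l_def)
  qed (use l in simp)
  with True show ?thesis
    by (simp add: end_round_def l_def)
next
  case False
  then have "(LEAST j. k \<le> j \<or> fst (h j) \<in> GammaX U \<epsilon>) = k"
    by (intro Least_equality) (use nat_le_linear in blast)+
  with False show ?thesis
    by (auto simp: end_round_def)
qed

lemma end_round_le: "end_round U \<epsilon> k h \<le> k"
  unfolding end_round_eq_Least by (rule Least_le) simp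

lemma end_round_stopped:
  assumes "\<exists>j\<le>k. fst (h j) \<in> GammaX U \<epsilon>"
  shows "fst (h (end_round U \<epsilon> k h)) \<in> GammaX U \<epsilon>"
  using assms by (auto simp: end_round_def intro: LeastI)

lemma end_round_running:
  assumes "\<not> (\<exists>j\<le>k. fst (h j) \<in> GammaX U \<epsilon>)"
  shows "end_round U \<epsilon> k h = k"
  using assms by (auto simp: end_round_def)

lemma end_round_Suc_stopped:
  assumes "\<exists>j\<le>k. fst (h j) \<in> GammaX U \<epsilon>"
  shows "end_round U \<epsilon> (Suc k) (h(Suc k := z)) = end_round U \<epsilon> k h"
proof -
  let ?l = "end_round U \<epsilon> k h"
  show ?thesis
    unfolding end_round_eq_Least[of _ _ "Suc k"]
  proof (rule Least_equality)
    have "?l \<noteq> Suc k" using end_round_le[of U \<epsilon> k h] by simp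
    then show "Suc k \<le> ?l \<or> fst ((h(Suc k := z)) ?l) \<in> GammaX U \<epsilon>"
      using end_round_stopped[OF assms] by simp
    fix i assume i: "Suc k \<le> i \<or> fst ((h(Suc k := z)) i) \<in> GammaX U \<epsilon>"
    show "?l \<le> i"
    proof (cases "i \<le> k")
      case True
      with i have "fst (h i) \<in> GammaX U \<epsilon>" by auto
      then show ?thesis
        unfolding end_round_eq_Least by (intro Least_le) simp
    qed (use end_round_le[of U \<epsilon> k h] in linarith)
  qed
qed

lemma end_round_Suc_running:
  assumes "\<not> (\<exists>j\<le>k. fst (h j) \<in> GammaX U \<epsilon>)"
  shows "end_round U \<epsilon> (Suc k) (h(Suc k := z)) = Suc k"
  unfolding end_round_eq_Least
  using assms by (intro Least_equality) (auto simp: not_less_eq_eq[symmetric] split: if_splits)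

text \<open>
The index \<open>end_round U \<epsilon> k h\<close> takes finitely many values; for each of them the sampled component is
measurable.
\<close>

lemma measurable_stopped:
  fixes f :: "nat \<Rightarrow> 'a::euclidean_space \<times> 'a \<Rightarrow> real"
  assumes "open U" and f: "\<And>j. f j \<in> borel_measurable (borel \<Otimes>\<^sub>M borel)"
  shows "(\<lambda>h. f (end_round U \<epsilon> k h) (h (end_round U \<epsilon> k h))) \<in> borel_measurable (PiM {0..<Suc k} (\<lambda>_. borel))"
proof -
  let ?H = "PiM {0..<Suc k} (\<lambda>_. borel :: ('a \<times> 'a) measure)"
  have comp: "(\<lambda>h. h j) \<in> ?H \<rightarrow>\<^sub>M borel \<Otimes>\<^sub>M borel" if "j \<le> k" for j
    unfolding borel_prod using that by (intro measurable_component_singleton) auto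
  have [measurable]: "GammaX U \<epsilon> \<in> sets borel"
    using closed_GammaX[OF \<open>open U\<close>] by (rule borel_closed)
  have P: "Measurable.pred ?H (\<lambda>h. k \<le> j \<or> fst (h j) \<in> GammaX U \<epsilon>)" for j
  proof (cases "k \<le> j")
    case False
    then have [measurable]: "(\<lambda>h. fst (h j)) \<in> ?H \<rightarrow>\<^sub>M borel"
      by (intro measurable_compose[OF comp measurable_fst]) simp
    show ?thesis by measurable
  qed simp
  \<comment> \<open>A history has no component beyond \<open>k\<close>, hence the truncation at \<open>k\<close> below.\<close>
  have "end_round U \<epsilon> k \<in> ?H \<rightarrow>\<^sub>M count_space UNIV"
    unfolding end_round_eq_Least by (intro measurable_Least P)
  moreover have "(\<lambda>h. if j \<le> k then f j (h j) else 0) \<in> borel_measurable ?H" for j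
    using measurable_compose[OF comp f] by (cases "j \<le> k") simp_all
  ultimately have "(\<lambda>h. if end_round U \<epsilon> k h \<le> k then f (end_round U \<epsilon> k h) (h (end_round U \<epsilon> k h)) else 0)
      \<in> borel_measurable ?H"
    by (rule measurable_compose_countable[rotated])
  then show ?thesis
    by (simp add: end_round_le)
qed

text \<open>
The clock stays positive until the last round and is in \<open>(- \<epsilon>\<^sup>2 / 2, 0]\<close> there, where \<open>F\<close> is
given on all of \<open>U\<close>.
\<close>

lemma max_rounds_time:
  assumes "\<epsilon> > 0" "t > 0"
  shows "k < max_rounds \<epsilon> t \<Longrightarrow> 0 < t - real k * \<epsilon>\<^sup>2 / 2"
    "t - real (max_rounds \<epsilon> t) * \<epsilon>\<^sup>2 / 2 \<le> 0"
    "k \<le> max_rounds \<epsilon> t \<Longrightarrow> - \<epsilon>\<^sup>2 / 2 < t - real k * \<epsilon>\<^sup>2 / 2"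
proof -
  let ?c = "\<epsilon>\<^sup>2 / 2"
  have c: "?c > 0" using assms by simp
  have N: "real (max_rounds \<epsilon> t) = of_int \<lceil>t / ?c\<rceil>"
    unfolding max_rounds_def using divide_pos_pos[OF \<open>t > 0\<close> c] by (intro of_nat_nat) linarith
  have lt: "real k * ?c < t" if "k < max_rounds \<epsilon> t" for k
  proof -
    have "real k + 1 \<le> of_int \<lceil>t / ?c\<rceil>"
      using that N by linarith
    then have "real k < t / ?c"
      by linarith
    then show ?thesis
      using c by (simp add: pos_less_divide_eq)
  qed
  show "0 < t - real k * \<epsilon>\<^sup>2 / 2" if "k < max_rounds \<epsilon> t"
    using lt[OF that] by simp
  have "t / ?c \<le> real (max_rounds \<epsilon> t)"
    unfolding N by linarith
  then show "t - real (max_rounds \<epsilon> t) * \<epsilon>\<^sup>2 / 2 \<le> 0"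
    using c by (simp add: pos_divide_le_eq)
  show "- \<epsilon>\<^sup>2 / 2 < t - real k * \<epsilon>\<^sup>2 / 2" if "k \<le> max_rounds \<epsilon> t"
  proof (cases k)
    case 0
    have "- \<epsilon>\<^sup>2 / 2 < 0" using c by simp
    then show ?thesis
      unfolding 0 of_nat_0 mult_zero_left div_0 diff_zero using \<open>t > 0\<close> by (rule less_trans)
  next
    case (Suc l)
    then show ?thesis
      using lt[of l] that by (simp add: algebra_simps)
  qed
qed

section \<open>Exchanging the players\<close>

text \<open>
The toss is fair, so the law of the play is unchanged when the players exchange their strategies.
\<close>

lemma expected_payoff_uminus:
  "expected_payoff U T p \<epsilon> (\<lambda>z. - F z) X Y t SI SII = - expected_payoff U T p \<epsilon> F X Y t SII SI"
proof -
  have "state_law p \<epsilon> SI SII (X, Y) = state_law p \<epsilon> SII SI (X, Y)"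
    by (intro ext) (simp add: state_law_def move_law_commute split: nat.split)
  moreover have "payoff U T \<epsilon> (\<lambda>z. - F z) t h = - payoff U T \<epsilon> F t h" for h
    by (simp add: payoff_def Let_def)
  ultimately show ?thesis
    by (simp add: expected_payoff_def play_law_def)
qed

lemma kolmogorov_function_uminus:
  fixes U :: "'a::euclidean_space set"
  assumes "kolmogorov_function U T p \<epsilon> F u"
  shows "kolmogorov_function U T p \<epsilon> (\<lambda>z. - F z) (\<lambda>z. - u z)"
proof -
  have SUP: "(SUP x\<in>A. - f x) = - (INF x\<in>A. f x)" and INF: "(INF x\<in>A. - f x) = - (SUP x\<in>A. f x)"
    for A :: "'a set" and f :: "'a \<Rightarrow> real"
    by (simp_all add: Inf_real_def image_image)
  have "(\<lambda>z. - u z) \<in> G'_class U T \<epsilon>"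
    using assms unfolding kolmogorov_function_def G'_class_def
    by (auto simp: bounded_iff abs_minus_commute)
  then show ?thesis
    using assms unfolding kolmogorov_function_def
    by (auto simp: SUP INF set_lebesgue_integral_def algebra_simps)
qed

section \<open>A strategy that guarantees the Kolmogorov function\<close>

locale kolmogorov_game =
  fixes U :: "'a::euclidean_space set" and T \<epsilon> :: real and p :: ereal
    and F u :: "'a \<times> 'a \<times> real \<Rightarrow> real"
  assumes open_U: "open U" and T_pos: "0 < T" and p: "2 \<le> p" and eps: "\<epsilon> > 0"
    and kolmogorov: "kolmogorov_function U T p \<epsilon> F u"
begin

text \<open>
\<open>u\<close> is arbitrary outside its domain. Replaced there by \<open>0\<close>, it becomes bounded and, at each time, jointly
Borel in \<open>(X, Y)\<close> and equicontinuous in \<open>Y\<close>, without side conditions.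
\<close>

definition ext_u :: "real \<Rightarrow> 'a \<times> 'a \<Rightarrow> real" where
  "ext_u t z = (if fst z \<in> UX_ext U \<epsilon> \<and> t \<in> {- \<epsilon>\<^sup>2 / 2 <.. T} then u (fst z, snd z, t) else 0)"

definition next_state :: "'a \<Rightarrow> 'a \<Rightarrow> 'a \<times> 'a" where
  "next_state Y x = (x, Y + (\<epsilon>\<^sup>2 / 2) *\<^sub>R x)"

lemma u_class: "u \<in> G'_class U T \<epsilon>"
  using kolmogorov by (simp add: kolmogorov_function_def)

lemma ext_u_bounded: "\<exists>B. \<forall>t z. \<bar>ext_u t z\<bar> \<le> B"
proof -
  obtain B where B: "\<And>z. z \<in> UX_ext U \<epsilon> \<times> UNIV \<times> {- \<epsilon>\<^sup>2 / 2 <.. T} \<Longrightarrow> \<bar>u z\<bar> \<le> B"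
    using u_class by (auto simp: G'_class_def bounded_iff)
  have "\<bar>ext_u t z\<bar> \<le> max B 0" for t z
    using B[of "(fst z, snd z, t)"] by (auto simp: ext_u_def)
  then show ?thesis by blast
qed

lemma ext_u_interior:
  assumes "X \<in> U" "0 < t" "t < T"
  shows "ext_u t (X, Y) = u (X, Y, t)"
proof -
  have "- \<epsilon>\<^sup>2 / 2 \<le> 0" by simp
  then have "- \<epsilon>\<^sup>2 / 2 < t"
    using \<open>0 < t\<close> by (rule le_less_trans)
  then show ?thesis
    using assms by (simp add: ext_u_def UX_ext_def)
qed

lemma ext_u_equicont:
  assumes "\<eta> > 0"
  shows "\<exists>\<delta>>0. \<forall>X Y1 Y2. dist Y1 Y2 < \<delta> \<longrightarrow> \<bar>ext_u t (X, Y1) - ext_u t (X, Y2)\<bar> < \<eta>"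
proof (cases "t \<in> {- \<epsilon>\<^sup>2 / 2 <.. T}")
  case True
  then obtain \<delta> where "\<delta> > 0" "\<forall>X Y1 Y2. dist Y1 Y2 < \<delta> \<and> X \<in> UX_ext U \<epsilon> \<longrightarrow> \<bar>u (X, Y1, t) - u (X, Y2, t)\<bar> < \<eta>"
    using u_class assms unfolding G'_class_def by blast
  with assms show ?thesis
    by (intro exI[of _ \<delta>]) (auto simp: ext_u_def)
next
  case False
  then have "ext_u t = (\<lambda>z. 0)"
    by (auto simp: ext_u_def)
  with assms show ?thesis
    by (intro exI[of _ 1]) simp
qed

lemma ext_u_continuous: "continuous_on UNIV (\<lambda>Y. ext_u t (X, Y))"
  unfolding continuous_on_iff
proof (intro ballI allI impI)
  fix y and e :: real assume "e > 0"
  from ext_u_equicont[OF this, of t] obtain \<delta> where "\<delta> > 0"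
      "\<forall>X Y1 Y2. dist Y1 Y2 < \<delta> \<longrightarrow> \<bar>ext_u t (X, Y1) - ext_u t (X, Y2)\<bar> < e"
    by blast
  then show "\<exists>d>0. \<forall>x'\<in>UNIV. dist x' y < d \<longrightarrow> dist (ext_u t (X, x')) (ext_u t (X, y)) < e"
    by (auto simp: dist_real_def)
qed

lemma U_borel: "U \<in> sets borel"
  using open_U by (rule borel_open)

lemma GammaX_borel: "GammaX U \<epsilon> \<in> sets borel"
  using closed_GammaX[OF open_U] by (rule borel_closed)

lemma ext_u_measurable: "ext_u t \<in> borel_measurable (borel \<Otimes>\<^sub>M borel)"
proof -
  have "(\<lambda>X. ext_u t (X, Y)) \<in> borel_measurable borel" for Y
  proof (cases "t \<in> {- \<epsilon>\<^sup>2 / 2 <.. T}")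
    case True
    have "UX_ext U \<epsilon> \<inter> space borel \<in> sets borel"
      using U_borel GammaX_borel by (simp add: UX_ext_def)
    moreover have "(\<lambda>X. u (X, Y, t)) \<in> borel_measurable (restrict_space borel (UX_ext U \<epsilon>))"
      using u_class True by (simp add: G'_class_def)
    ultimately have "(\<lambda>X. indicator (UX_ext U \<epsilon>) X * u (X, Y, t)) \<in> borel_measurable borel"
      by (simp add: borel_measurable_restrict_space_iff)
    also have "(\<lambda>X. indicator (UX_ext U \<epsilon>) X * u (X, Y, t)) = (\<lambda>X. ext_u t (X, Y))"
      using True by (auto simp: ext_u_def)
    finally show ?thesis .
  next
    case False
    then have "(\<lambda>X. ext_u t (X, Y)) = (\<lambda>X. 0)"
      by (auto simp: ext_u_def)
    then show ?thesis by simp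
  qed
  then have "(\<lambda>z. ext_u t (fst z, snd z)) \<in> borel_measurable (borel \<Otimes>\<^sub>M borel)"
    using ext_u_continuous by (rule borel_measurable_Caratheodory)
  then show ?thesis by simp
qed

lemma next_state_measurable: "next_state Y \<in> borel \<rightarrow>\<^sub>M borel \<Otimes>\<^sub>M borel"
  unfolding next_state_def by measurable

text \<open>
The greedy player loses at most \<open>\<eta>\<close> compared with the supremum, the opponent does not get below the infimum,
and the random move contributes the average exactly; weighted, this is the Kolmogorov equation up to \<open>\<eta>\<close>.
\<close>

lemma one_round:
  assumes X: "X \<in> U" and t: "0 < t" "t < T" and ab: "a \<in> ball X \<epsilon>" "b \<in> ball X \<epsilon>" and "\<eta> \<ge> 0"
    and a: "\<And>x. x \<in> ball X \<epsilon> \<Longrightarrow> ext_u (t - \<epsilon>\<^sup>2 / 2) (next_state Y x) \<le> ext_u (t - \<epsilon>\<^sup>2 / 2) (next_state Y a) + \<eta>"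
  shows "ext_u t (X, Y) - \<eta> \<le> (LINT x|move_law p \<epsilon> X a b. ext_u (t - \<epsilon>\<^sup>2 / 2) (next_state Y x))"
proof -
  let ?g = "\<lambda>x. ext_u (t - \<epsilon>\<^sup>2 / 2) (next_state Y x)" and ?u = "\<lambda>x. u (x, Y + (\<epsilon>\<^sup>2 / 2) *\<^sub>R x, t - \<epsilon>\<^sup>2 / 2)"
  let ?\<alpha> = "alpha_coeff DIM('a) p" and ?\<beta> = "beta_coeff DIM('a) p"
  have "\<epsilon>\<^sup>2 > 0" using eps by simp
  then have "- \<epsilon>\<^sup>2 / 2 < t - \<epsilon>\<^sup>2 / 2" "t - \<epsilon>\<^sup>2 / 2 \<le> T"
    using t by linarith+
  then have gu: "?g x = ?u x" if "x \<in> ball X \<epsilon>" for x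
    using ball_subset_UX_ext[OF X, of \<epsilon>] that by (auto simp: ext_u_def next_state_def)
  obtain B where B: "\<And>t z. \<bar>ext_u t z\<bar> \<le> B"
    using ext_u_bounded by blast
  have ball_ne: "ball X \<epsilon> \<noteq> {}" using eps by simp
  have INT: "(LINT x:ball X \<epsilon>|lborel. ?u x) = (LINT x:ball X \<epsilon>|lborel. ?g x)"
    unfolding set_lebesgue_integral_def using gu by (intro Bochner_Integration.integral_cong) (auto simp: indicator_def)
  have SUP: "(SUP x\<in>ball X \<epsilon>. ?u x) \<le> ?g a + \<eta>"
    using ball_ne a gu by (intro cSUP_least) auto
  have "bdd_below (?u ` ball X \<epsilon>)"
  proof (rule bdd_belowI2)
    fix x assume "x \<in> ball X \<epsilon>"
    then show "- B \<le> ?u x"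
      using B[of "t - \<epsilon>\<^sup>2 / 2" "next_state Y x"] gu[of x] by simp
  qed
  then have "(INF x\<in>ball X \<epsilon>. ?u x) \<le> ?u b"
    using ab(2) by (rule cINF_lower)
  then have INF: "(INF x\<in>ball X \<epsilon>. ?u x) \<le> ?g b"
    using gu[OF ab(2)] by simp
  have \<alpha>: "0 \<le> ?\<alpha>" "?\<alpha> \<le> 1"
    using coeffs_convex[OF p, of "DIM('a)"] by simp_all
  have "ext_u t (X, Y) = u (X, Y, t)"
    using X t by (rule ext_u_interior)
  also have "\<dots> = ?\<alpha> / 2 * ((SUP x\<in>ball X \<epsilon>. ?u x) + (INF x\<in>ball X \<epsilon>. ?u x)) +
      ?\<beta> / measure lborel (ball X \<epsilon>) * (LINT x:ball X \<epsilon>|lborel. ?u x)"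
    using kolmogorov X t unfolding kolmogorov_function_def by simp
  also have "\<dots> \<le> ?\<alpha> / 2 * ((?g a + \<eta>) + ?g b) +
      ?\<beta> / measure lborel (ball X \<epsilon>) * (LINT x:ball X \<epsilon>|lborel. ?g x)"
    unfolding INT using \<alpha> SUP INF by (intro add_right_mono mult_left_mono add_mono) auto
  also have "\<dots> = (LINT x|move_law p \<epsilon> X a b. ?g x) + ?\<alpha> / 2 * \<eta>"
    by (subst integral_move_law[OF p eps measurable_compose[OF next_state_measurable ext_u_measurable] B])
       (simp add: algebra_simps)
  also have "?\<alpha> / 2 * \<eta> \<le> 1 * \<eta>"
    using \<alpha> \<open>\<eta> \<ge> 0\<close> by (intro mult_right_mono) auto
  finally show ?thesis by simp
qed

text \<open>
The greedy strategy looks at the current state only. The sequence \<open>s\<close> gives the times at which \<open>u\<close> is to be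
maximized.
\<close>

lemma near_optimal_strategy:
  assumes "\<eta> > 0"
  obtains SI where "SI \<in> strategies \<epsilon>"
    "\<And>k h x. x \<in> ball (fst (h k)) \<epsilon> \<Longrightarrow>
      ext_u (s k) (next_state (snd (h k)) x) \<le> ext_u (s k) (next_state (snd (h k)) (SI k h)) + \<eta>"
proof -
  obtain B where B: "\<And>t z. \<bar>ext_u t z\<bar> \<le> B"
    using ext_u_bounded by blast
  have "\<exists>S. S \<in> borel_measurable (borel \<Otimes>\<^sub>M borel) \<and> (\<forall>X Y. S (X, Y) \<in> ball X \<epsilon>) \<and>
      (\<forall>X Y. \<forall>x\<in>ball X \<epsilon>. ext_u t (next_state Y x) \<le> ext_u t (next_state Y (S (X, Y))) + \<eta>)" for t
  proof -
    have "\<exists>\<delta>>0. \<forall>x Y1 Y2. dist Y1 Y2 < \<delta> \<longrightarrow> \<bar>ext_u t (next_state Y1 x) - ext_u t (next_state Y2 x)\<bar> < \<eta>" if "\<eta> > 0" for \<eta>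
      using ext_u_equicont[OF that, of t] unfolding next_state_def by (metis dist_add_cancel2)
    from borel_near_optimal_selection[where G = "\<lambda>x Y. ext_u t (next_state Y x)", OF this B eps \<open>\<eta> > 0\<close>]
    show ?thesis by metis
  qed
  then obtain S where S: "\<And>t. S t \<in> borel_measurable (borel \<Otimes>\<^sub>M borel)" "\<And>t X Y. S t (X, Y) \<in> ball X \<epsilon>"
      "\<And>t X Y x. x \<in> ball X \<epsilon> \<Longrightarrow> ext_u t (next_state Y x) \<le> ext_u t (next_state Y (S t (X, Y))) + \<eta>"
    by metis
  show thesis
  proof
    have "(\<lambda>h. h k) \<in> PiM {0..<Suc k} (\<lambda>_. borel :: ('a \<times> 'a) measure) \<rightarrow>\<^sub>M borel \<Otimes>\<^sub>M borel" for k
      unfolding borel_prod by (rule measurable_component_singleton) simp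
    from measurable_compose[OF this S(1)] S(2)
    show "(\<lambda>k h. S (s k) (h k)) \<in> strategies \<epsilon>"
      unfolding strategies_def by (auto simp: mem_ball simp del: mem_ball) (metis mem_ball prod.collapse)
    show "ext_u (s k) (next_state (snd (h k)) x) \<le> ext_u (s k) (next_state (snd (h k)) (S (s k) (h k))) + \<eta>"
      if "x \<in> ball (fst (h k)) \<epsilon>" for k x and h :: "nat \<Rightarrow> 'a \<times> 'a"
      using S(3)[OF that, of "s k" "snd (h k)"] by simp
  qed
qed

lemma ext_u_eq_F:
  assumes "(X, Y, t) \<in> Gamma U T \<epsilon>"
  shows "ext_u t (X, Y) = F (X, Y, t)"
proof -
  have "u (X, Y, t) = F (X, Y, t)"
    using kolmogorov assms by (simp add: kolmogorov_function_def)
  then show ?thesis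
    using assms T_pos by (auto simp: ext_u_def Gamma_def UX_ext_def)
qed

text \<open>
On \<open>Gamma U T \<epsilon>\<close> the payoff can be read off from \<open>u\<close>, which provides the joint measurability in \<open>(X, Y)\<close>.
\<close>

lemma payoff_stopped:
  fixes h :: "nat \<Rightarrow> 'a \<times> 'a" and t :: real
  defines "l \<equiv> end_round U \<epsilon> (max_rounds \<epsilon> t) h"
  shows "payoff U T \<epsilon> F t h =
    (if (fst (h l), snd (h l), t - real l * \<epsilon>\<^sup>2 / 2) \<in> Gamma U T \<epsilon> then ext_u (t - real l * \<epsilon>\<^sup>2 / 2) (h l) else 0)"
  using ext_u_eq_F[of "fst (h l)" "snd (h l)" "t - real l * \<epsilon>\<^sup>2 / 2"]
  by (simp add: payoff_def Let_def l_def)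

lemma payoff_measurable:
  "payoff U T \<epsilon> F t \<in> borel_measurable (PiM {0..<Suc (max_rounds \<epsilon> t)} (\<lambda>_. borel))"
proof -
  have "Measurable.pred (borel \<Otimes>\<^sub>M borel) (\<lambda>z :: 'a \<times> 'a. (fst z, snd z, r) \<in> Gamma U T \<epsilon>)" for r
  proof -
    note [measurable] = U_borel GammaX_borel
    show ?thesis
      unfolding Gamma_def by simp
  qed
  then have "(\<lambda>z. if (fst z, snd z, r) \<in> Gamma U T \<epsilon> then ext_u r z else 0) \<in> borel_measurable (borel \<Otimes>\<^sub>M borel)" for r
    using ext_u_measurable by (intro measurable_If) auto
  then show ?thesis
    unfolding payoff_stopped by (intro measurable_stopped[OF open_U,
      where f = "\<lambda>j z. if (fst z, snd z, t - real j * \<epsilon>\<^sup>2 / 2) \<in> Gamma U T \<epsilon> then ext_u (t - real j * \<epsilon>\<^sup>2 / 2) z else 0"])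
qed

lemma expected_payoff_bounded:
  "\<exists>B. \<forall>SI\<in>strategies \<epsilon>. \<forall>SII\<in>strategies \<epsilon>. \<bar>expected_payoff U T p \<epsilon> F X Y t SI SII\<bar> \<le> B"
proof -
  obtain B where B: "\<And>t z. \<bar>ext_u t z\<bar> \<le> B"
    using ext_u_bounded by blast
  have "B \<ge> 0"
    using B[of 0 undefined] by linarith
  have "\<bar>expected_payoff U T p \<epsilon> F X Y t SI SII\<bar> \<le> B"
    if S: "SI \<in> strategies \<epsilon>" "SII \<in> strategies \<epsilon>" for SI SII
  proof -
    interpret IT: Ionescu_Tulcea "state_law p \<epsilon> SI SII (X, Y)" "\<lambda>_. borel"
      by (rule Ionescu_Tulcea_state_law[OF p eps S])
    have start: "(\<lambda>_. undefined) \<in> space (PiM {0..<0} (\<lambda>_. borel :: ('a \<times> 'a) measure))"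
      by (auto simp: space_PiM PiE_iff extensional_def)
    let ?L = "IT.C 0 (Suc (max_rounds \<epsilon> t)) (\<lambda>_. undefined)"
    have sets: "sets ?L = sets (PiM {0..<Suc (max_rounds \<epsilon> t)} (\<lambda>_. borel))"
      using IT.sets_C[OF start, of "Suc (max_rounds \<epsilon> t)"] by simp
    show ?thesis
      unfolding expected_payoff_def play_law_def
    proof (rule prob_space.abs_expectation_le)
      show "prob_space ?L"
        by (rule IT.prob_space_C[OF start])
      show "payoff U T \<epsilon> F t \<in> borel_measurable ?L"
        using payoff_measurable[of t] by (simp only: measurable_cong_sets[OF sets refl])
      show "\<bar>payoff U T \<epsilon> F t h\<bar> \<le> B" for h
        unfolding payoff_stopped using B \<open>B \<ge> 0\<close> by simp
    qed
  qed
  then show ?thesis by blast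
qed

text \<open>
If Player I is greedy up to \<open>\<eta>\<close>, the value of \<open>u\<close> along the stopped play, increased by \<open>\<eta>\<close> per
round, is a submartingale for every strategy of Player II. The induction follows the composition of kernels that
defines the law of the play, and compares the expectations before and after appending one state.
\<close>

lemma expected_payoff_ge:
  fixes t :: real
  defines "N \<equiv> max_rounds \<epsilon> t" and "s \<equiv> \<lambda>k. t - real k * \<epsilon>\<^sup>2 / 2"
  assumes X0: "X0 \<in> U" and t: "0 < t" "t < T" and S: "SI \<in> strategies \<epsilon>" "SII \<in> strategies \<epsilon>"
    and "\<eta> \<ge> 0"
    and near: "\<And>k h x. x \<in> ball (fst (h k)) \<epsilon> \<Longrightarrow>
      ext_u (s (Suc k)) (next_state (snd (h k)) x) \<le> ext_u (s (Suc k)) (next_state (snd (h k)) (SI k h)) + \<eta>"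
  shows "u (X0, Y0, t) - real N * \<eta> \<le> expected_payoff U T p \<epsilon> F X0 Y0 t SI SII"
proof -
  interpret IT: Ionescu_Tulcea "state_law p \<epsilon> SI SII (X0, Y0)" "\<lambda>_. borel"
    by (rule Ionescu_Tulcea_state_law[OF p eps S])
  let ?H = "\<lambda>n :: nat. PiM {0..<n} (\<lambda>_. borel :: ('a \<times> 'a) measure)"
  define L where "L k = IT.C 0 (Suc k) (\<lambda>_. undefined)" for k
  have start: "(\<lambda>_. undefined) \<in> space (?H 0)"
    by (auto simp: space_PiM PiE_iff extensional_def)
  have start1: "(\<lambda>_. undefined)(0 := (X0, Y0)) \<in> space (?H 1)"
    by (simp add: space_PiM PiE_iff extensional_def)
  have L_space: "space (L k) = space (?H (Suc k))" and L_sets: "sets (L k) = sets (?H (Suc k))"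
    and L_prob: "prob_space (L k)" for k
    unfolding L_def using IT.space_C[OF start, of "Suc k"] IT.sets_C[OF start, of "Suc k"]
      IT.prob_space_C[OF start, of "Suc k"] by simp_all
  have L_Suc: "L (Suc k) = L k \<bind> IT.eP (Suc k)" for k
    by (simp add: L_def)
  have eP_meas: "IT.eP (Suc k) \<in> L k \<rightarrow>\<^sub>M subprob_algebra (?H (Suc (Suc k)))" for k
    using IT.measurable_eP[of "Suc k"] by (simp add: measurable_cong_sets[OF L_sets refl])
  define append_state where "append_state k h x = h(Suc k := next_state (snd (h k)) x)" for k x and h :: "nat \<Rightarrow> 'a \<times> 'a"
  define law where "law k h = move_law p \<epsilon> (fst (h k)) (SI k h) (SII k h)" for k and h :: "nat \<Rightarrow> 'a \<times> 'a"
  have next_state_meas: "next_state Y \<in> borel \<rightarrow>\<^sub>M borel" for Y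
    using next_state_measurable[of Y] by (simp add: borel_prod)
  have upd_meas: "fun_upd h (Suc k) \<in> borel \<rightarrow>\<^sub>M ?H (Suc (Suc k))" if "h \<in> space (?H (Suc k))" for k h
    using that by (intro measurable_fun_upd[where J = "{0..<Suc k}"]) auto
  have next_meas: "append_state k h \<in> law k h \<rightarrow>\<^sub>M ?H (Suc (Suc k))" if "h \<in> space (?H (Suc k))" for k h
    unfolding append_state_def law_def using measurable_compose[OF next_state_meas upd_meas[OF that]]
    by (simp add: measurable_cong_sets[OF sets_move_law refl])
  have eP: "IT.eP (Suc k) h = distr (law k h) (?H (Suc (Suc k))) (append_state k h)"
    if "h \<in> space (?H (Suc k))" for k h
    using next_state_meas upd_meas[OF that]
    by (simp add: IT.eP_def state_law_def law_def append_state_def[abs_def] distr_distr comp_def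
        measurable_cong_sets[OF sets_move_law refl] next_state_def[abs_def])
  have L0: "L 0 = return (?H 1) ((\<lambda>_. undefined)(0 := (X0, Y0)))"
  proof -
    have "L 0 = IT.eP 0 (\<lambda>_. undefined)"
      unfolding L_def using start IT.measurable_eP[of 0] by (simp add: bind_return)
    also have "\<dots> = distr (return borel (X0, Y0)) (?H 1) (fun_upd (\<lambda>_. undefined) 0)"
      by (simp add: IT.eP_def state_law_def)
    also have "\<dots> = return (?H 1) ((\<lambda>_. undefined)(0 := (X0, Y0)))"
      using start by (intro distr_return measurable_fun_upd[where J = "{0..<0}"]) auto
    finally show ?thesis .
  qed
  define stopped where "stopped k h \<longleftrightarrow> (\<exists>j\<le>k. fst (h j) \<in> GammaX U \<epsilon>)" for k and h :: "nat \<Rightarrow> 'a \<times> 'a"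
  \<comment> \<open>Along a play, the token cannot be outside \<open>U\<close> without having entered the strip. The exceptional
    histories form a null set; they are excluded because the one-round estimate starts from a state in \<open>U\<close>.\<close>
  define legal where "legal k h \<longleftrightarrow> stopped k h \<or> fst (h k) \<in> U" for k and h :: "nat \<Rightarrow> 'a \<times> 'a"
  \<comment> \<open>The value of \<open>u\<close> at the stopped state: the submartingale up to the error \<open>\<eta>\<close> per round.\<close>
  define \<Phi> where "\<Phi> k h = ext_u (s (end_round U \<epsilon> k h)) (h (end_round U \<epsilon> k h))" for k and h :: "nat \<Rightarrow> 'a \<times> 'a"
  obtain B where B: "\<And>t z. \<bar>ext_u t z\<bar> \<le> B"
    using ext_u_bounded by blast
  have \<Phi>_meas: "\<Phi> k \<in> borel_measurable (?H (Suc k))" for k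
    unfolding \<Phi>_def by (rule measurable_stopped[OF open_U ext_u_measurable])
  have \<Phi>_bound: "\<bar>\<Phi> k h\<bar> \<le> B" for k h
    unfolding \<Phi>_def by (rule B)
  have \<Phi>_int: "integrable (L k) (\<Phi> k)" for k
  proof -
    interpret prob_space "L k" by (rule L_prob)
    show ?thesis
      using \<Phi>_meas[of k] \<Phi>_bound
      by (intro integrable_const_bound[of _ B]) (auto simp: measurable_cong_sets[OF L_sets refl])
  qed
  have legal_meas: "Measurable.pred (?H (Suc k)) (legal k)" for k
  proof -
    have comp: "(\<lambda>h. fst (h j)) \<in> ?H (Suc k) \<rightarrow>\<^sub>M borel" if "j \<le> k" for j
    proof -
      have "(\<lambda>h. h j) \<in> ?H (Suc k) \<rightarrow>\<^sub>M borel \<Otimes>\<^sub>M borel"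
        unfolding borel_prod using that by (intro measurable_component_singleton) auto
      from measurable_compose[OF this measurable_fst] show ?thesis .
    qed
    have "Measurable.pred (?H (Suc k)) (\<lambda>h. fst (h j) \<in> A)" if "A \<in> sets borel" "j \<le> k" for A j
      using that(1) comp[OF that(2)] by measurable
    then show ?thesis
      unfolding legal_def stopped_def using U_borel GammaX_borel
      by (intro pred_intros_logic pred_intros_finite) auto
  qed
  have law_prob: "prob_space (law k h)" for k h
    unfolding law_def by (rule prob_space_move_law[OF p eps])
  have choice_ball: "SI k h \<in> ball (fst (h k)) \<epsilon>" "SII k h \<in> ball (fst (h k)) \<epsilon>"
    if "h \<in> space (?H (Suc k))" for k h
    using S that by (auto simp: strategies_def simp del: mem_ball)
  have stopped_next: "stopped (Suc k) (append_state k h x)" if st: "stopped k h" for k h x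
  proof -
    obtain j where "j \<le> k" "fst (h j) \<in> GammaX U \<epsilon>"
      using st by (auto simp: stopped_def)
    then show ?thesis
      unfolding stopped_def append_state_def by (intro exI[of _ j]) auto
  qed
  have legal_step: "AE x in law k h. legal (Suc k) (append_state k h x)"
    if h: "h \<in> space (?H (Suc k))" and "legal k h" for k h
  proof (cases "stopped k h")
    case True
    then show ?thesis
      using stopped_next by (simp add: legal_def)
  next
    case False
    then have "fst (h k) \<in> U"
      using \<open>legal k h\<close> by (simp add: legal_def)
    then have "ball (fst (h k)) \<epsilon> \<subseteq> U \<union> GammaX U \<epsilon>"
      using ball_subset_UX_ext by (simp add: UX_ext_def)
    then have stays: "legal (Suc k) (append_state k h x)" if "x \<in> ball (fst (h k)) \<epsilon>" for x
      using that by (auto simp: legal_def stopped_def append_state_def next_state_def)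
    show ?thesis
      unfolding law_def by (rule eventually_mono[OF AE_move_law_ball[OF choice_ball[OF h]] stays])
  qed
  have AE_legal: "AE h in L k. legal k h" for k
  proof (induction k)
    case 0
    have "legal 0 ((\<lambda>_. undefined)(0 := (X0, Y0)))"
      using X0 by (simp add: legal_def)
    then show ?case
      unfolding L0 using legal_meas[of 0] start1 by (subst AE_return) auto
  next
    case (Suc k)
    have "AE h in L k. AE h' in IT.eP (Suc k) h. legal (Suc k) h'"
      using Suc.IH AE_space
    proof eventually_elim
      case (elim h)
      then have h: "h \<in> space (?H (Suc k))"
        by (simp add: L_space)
      show ?case
        unfolding eP[OF h] using legal_meas[of "Suc k"] legal_step[OF h elim(1)]
        by (subst AE_distr_iff[OF next_meas[OF h]]) (auto simp: pred_def)
    qed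
    then show ?case
      unfolding L_Suc by (subst AE_bind[OF eP_meas legal_meas])
  qed
  have \<Phi>_step: "\<Phi> k h - \<eta> \<le> (LINT x|law k h. \<Phi> (Suc k) (append_state k h x))"
    if h: "h \<in> space (?H (Suc k))" and "legal k h" "k < N" for k h
  proof (cases "stopped k h")
    case True
    let ?l = "end_round U \<epsilon> k h"
    interpret prob_space "law k h" by (rule law_prob)
    have "?l \<noteq> Suc k"
      using end_round_le[of U \<epsilon> k h] by simp
    then have "\<Phi> (Suc k) (append_state k h x) = \<Phi> k h" for x
      using True by (simp add: \<Phi>_def append_state_def stopped_def end_round_Suc_stopped)
    then show ?thesis
      using \<open>\<eta> \<ge> 0\<close> prob_space by simp
  next
    case False
    then have "fst (h k) \<in> U"
      using \<open>legal k h\<close> by (simp add: legal_def)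
    have \<Phi>k: "\<Phi> k h = ext_u (s k) (fst (h k), snd (h k))"
      using False by (simp add: \<Phi>_def stopped_def end_round_running)
    have \<Phi>Suc: "\<Phi> (Suc k) (append_state k h x) = ext_u (s (Suc k)) (next_state (snd (h k)) x)" for x
      using False by (simp add: \<Phi>_def append_state_def stopped_def end_round_Suc_running)
    have s_Suc: "s (Suc k) = s k - \<epsilon>\<^sup>2 / 2"
      by (simp add: s_def field_simps)
    have "0 < s k" "s k < T"
    proof -
      show "0 < s k"
        using max_rounds_time(1)[OF eps t(1)] \<open>k < N\<close> by (simp add: s_def N_def)
      have "0 \<le> real k * \<epsilon>\<^sup>2 / 2" by simp
      then show "s k < T"
        using t(2) unfolding s_def by linarith
    qed
    then show ?thesis
      unfolding \<Phi>k \<Phi>Suc law_def s_Suc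
      using \<open>fst (h k) \<in> U\<close> choice_ball[OF h] \<open>\<eta> \<ge> 0\<close> near[where k = k and h = h]
      by (intro one_round) (simp_all add: s_Suc)
  qed
  have \<Phi>_expect: "ext_u t (X0, Y0) - real k * \<eta> \<le> (LINT h|L k. \<Phi> k h)" if "k \<le> N" for k
    using that
  proof (induction k)
    case 0
    have "(LINT h|L 0. \<Phi> 0 h) = \<Phi> 0 ((\<lambda>_. undefined)(0 := (X0, Y0)))"
      unfolding L0 using \<Phi>_meas[of 0] start1 by (intro integral_return) auto
    also have "\<dots> = ext_u t (X0, Y0)"
      using end_round_le[of U \<epsilon> 0] by (simp add: \<Phi>_def s_def)
    finally show ?case by simp
  next
    case (Suc k)
    interpret prob_space "L k" by (rule L_prob)
    let ?E = "\<lambda>h. LINT h'|IT.eP (Suc k) h. \<Phi> (Suc k) h'"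
    have E_meas: "?E \<in> borel_measurable (L k)"
      by (rule measurable_compose[OF eP_meas integral_measurable_subprob_algebra[OF \<Phi>_meas]])
    have eP_prob: "prob_space (IT.eP (Suc k) h)" if "h \<in> space (L k)" for h
      using that by (intro IT.prob_space_eP) (simp add: L_space)
    have E_eq: "?E h = (LINT x|law k h. \<Phi> (Suc k) (append_state k h x))" if "h \<in> space (L k)" for h
    proof -
      have h: "h \<in> space (?H (Suc k))" using that by (simp add: L_space)
      show ?thesis
        unfolding eP[OF h] by (rule integral_distr[OF next_meas[OF h] \<Phi>_meas])
    qed
    have E_bound: "\<bar>?E h\<bar> \<le> B" if "h \<in> space (L k)" for h
    proof -
      have sets_eP: "sets (IT.eP (Suc k) h) = sets (?H (Suc (Suc k)))"
        using that by (intro IT.sets_eP) (simp add: L_space)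
      then have "\<Phi> (Suc k) \<in> borel_measurable (IT.eP (Suc k) h)"
        using \<Phi>_meas[of "Suc k"] by (simp only: measurable_cong_sets[OF sets_eP refl])
      then show ?thesis
        using \<Phi>_bound by (rule prob_space.abs_expectation_le[OF eP_prob[OF that]])
    qed
    have E_int: "integrable (L k) ?E"
      using E_meas E_bound by (intro integrable_const_bound[of _ B]) auto
    have "ext_u t (X0, Y0) - real (Suc k) * \<eta> \<le> (LINT h|L k. \<Phi> k h) - \<eta>"
      using Suc by (simp add: algebra_simps)
    also have "\<dots> = (LINT h|L k. \<Phi> k h - \<eta>)"
      using \<Phi>_int[of k] prob_space by simp
    also have "\<dots> \<le> (LINT h|L k. ?E h)"
    proof (rule integral_mono_AE)
      show "AE h in L k. \<Phi> k h - \<eta> \<le> ?E h"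
        using AE_legal[of k] AE_space
      proof eventually_elim
        case (elim h)
        then show ?case
          using \<Phi>_step[of h k] Suc.prems by (simp add: E_eq L_space)
      qed
    qed (use \<Phi>_int[of k] E_int in simp_all)
    also have "\<dots> = (LINT h|L (Suc k). \<Phi> (Suc k) h)"
      unfolding L_Suc
    proof (rule integral_bind[symmetric, OF \<Phi>_meas \<Phi>_bound eP_meas])
      show "finite_measure (L k)" by unfold_locales
      show "AE h in L k. emeasure (IT.eP (Suc k) h) (space (IT.eP (Suc k) h)) \<le> ennreal 1"
        using prob_space.emeasure_space_1[OF eP_prob] by (intro AE_I2) simp
    qed
    finally show ?case .
  qed
  have payoff_eq: "payoff U T \<epsilon> F t h = \<Phi> N h" if "legal N h" for h
  proof -
    let ?l = "end_round U \<epsilon> N h"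
    have "s ?l > - \<epsilon>\<^sup>2 / 2"
      unfolding s_def N_def by (rule max_rounds_time(3)[OF eps t(1) end_round_le])
    moreover have "s ?l \<le> T"
    proof -
      have "0 \<le> real ?l * \<epsilon>\<^sup>2 / 2" by simp
      then show ?thesis using t(2) unfolding s_def by linarith
    qed
    moreover have "fst (h ?l) \<in> GammaX U \<epsilon> \<or> fst (h ?l) \<in> U \<and> s ?l \<le> 0"
    proof (cases "stopped N h")
      case True
      then show ?thesis
        unfolding stopped_def by (intro disjI1 end_round_stopped)
    next
      case False
      then have "?l = N"
        unfolding stopped_def by (rule end_round_running)
      then show ?thesis
        using that False max_rounds_time(2)[OF eps t(1)] by (simp add: legal_def s_def N_def)
    qed
    ultimately have "(fst (h ?l), snd (h ?l), s ?l) \<in> Gamma U T \<epsilon>"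
      by (auto simp: Gamma_def)
    then show ?thesis
      using ext_u_eq_F[of "fst (h ?l)" "snd (h ?l)" "s ?l"]
      by (simp add: payoff_def Let_def \<Phi>_def N_def[symmetric] s_def)
  qed
  have "u (X0, Y0, t) - real N * \<eta> \<le> (LINT h|L N. \<Phi> N h)"
  proof -
    have "ext_u t (X0, Y0) = u (X0, Y0, t)"
      using X0 t by (rule ext_u_interior)
    then show ?thesis
      using \<Phi>_expect[of N] by simp
  qed
  also have "\<dots> = (LINT h|L N. payoff U T \<epsilon> F t h)"
  proof (rule integral_cong_AE)
    show "\<Phi> N \<in> borel_measurable (L N)"
      using \<Phi>_meas[of N] by (simp add: measurable_cong_sets[OF L_sets refl])
    show "payoff U T \<epsilon> F t \<in> borel_measurable (L N)"
      using payoff_measurable[of t] by (simp add: measurable_cong_sets[OF L_sets refl] N_def)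
    show "AE h in L N. \<Phi> N h = payoff U T \<epsilon> F t h"
      using AE_legal[of N] by eventually_elim (simp add: payoff_eq)
  qed
  also have "\<dots> = expected_payoff U T p \<epsilon> F X0 Y0 t SI SII"
    by (simp add: expected_payoff_def play_law_def L_def N_def)
  finally show ?thesis .
qed

text \<open>
The number of rounds is bounded in advance by some \<open>N\<close>, so an error budget \<open>\<eta>\<close> can be divided evenly; the
divisor \<open>N + 1\<close> is positive by its form.
\<close>

lemma near_optimal_expected_payoff:
  assumes X: "X \<in> U" and t: "0 < t" "t < T" and "\<eta> > 0"
  shows "\<exists>SI\<in>strategies \<epsilon>. \<forall>SII\<in>strategies \<epsilon>. u (X, Y, t) - \<eta> \<le> expected_payoff U T p \<epsilon> F X Y t SI SII"
proof -
  let ?N = "real (max_rounds \<epsilon> t)"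
  have "\<eta> / (?N + 1) > 0"
    using \<open>\<eta> > 0\<close> by simp
  then obtain SI where SI: "SI \<in> strategies \<epsilon>"
      "\<And>k h x. x \<in> ball (fst (h k)) \<epsilon> \<Longrightarrow> ext_u (t - real (Suc k) * \<epsilon>\<^sup>2 / 2) (next_state (snd (h k)) x) \<le>
        ext_u (t - real (Suc k) * \<epsilon>\<^sup>2 / 2) (next_state (snd (h k)) (SI k h)) + \<eta> / (?N + 1)"
    using near_optimal_strategy[where s = "\<lambda>k. t - real (Suc k) * \<epsilon>\<^sup>2 / 2"] by blast
  have "?N * (\<eta> / (?N + 1)) \<le> \<eta>"
    using \<open>\<eta> > 0\<close> by (simp add: field_simps)
  moreover have "u (X, Y, t) - ?N * (\<eta> / (?N + 1)) \<le> expected_payoff U T p \<epsilon> F X Y t SI SII"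
    if "SII \<in> strategies \<epsilon>" for SII
    using SI \<open>\<eta> / (?N + 1) > 0\<close> by (intro expected_payoff_ge X t that) auto
  ultimately show ?thesis
    using SI(1) by (intro bexI[of _ SI] ballI) fastforce+
qed

end

section \<open>Equality of the values\<close>

text \<open>
A lower guarantee for one side and an upper guarantee for the other with the same \<open>v\<close> squeeze both iterated
extrema. Boundedness matters because suprema and infima of unbounded sets of reals are unspecified.
\<close>

lemma saddle_point_value:
  fixes E :: "'s \<Rightarrow> 's \<Rightarrow> real"
  assumes bounded: "\<And>a b. a \<in> A \<Longrightarrow> b \<in> A \<Longrightarrow> \<bar>E a b\<bar> \<le> B"
    and lower: "\<And>\<eta>. \<eta> > 0 \<Longrightarrow> \<exists>a\<in>A. \<forall>b\<in>A. v - \<eta> \<le> E a b"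
    and upper: "\<And>\<eta>. \<eta> > 0 \<Longrightarrow> \<exists>b\<in>A. \<forall>a\<in>A. E a b \<le> v + \<eta>"
  shows "(SUP a\<in>A. INF b\<in>A. E a b) = v" "(INF b\<in>A. SUP a\<in>A. E a b) = v"
proof -
  have ne: "A \<noteq> {}"
    using lower[of 1] by auto
  have le_B: "E a b \<le> B" and ge_B: "- B \<le> E a b" if "a \<in> A" "b \<in> A" for a b
    using bounded[OF that] by (simp_all add: abs_le_iff)
  have below: "bdd_below (E a ` A)" if "a \<in> A" for a
    by (rule bdd_belowI2[of _ "- B"]) (rule ge_B[OF that])
  have above: "bdd_above ((\<lambda>a. E a b) ` A)" if "b \<in> A" for b
    by (rule bdd_aboveI2[of _ _ B]) (rule le_B[OF _ that])
  obtain a0 where a0: "a0 \<in> A" using ne by blast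
  have INF_le: "(INF b\<in>A. E a b) \<le> v + \<eta>" if "a \<in> A" "\<eta> > 0" for a \<eta>
    using upper[OF \<open>\<eta> > 0\<close>] below[OF \<open>a \<in> A\<close>] \<open>a \<in> A\<close> by (meson cINF_lower order_trans)
  have le_SUP: "v - \<eta> \<le> (SUP a\<in>A. E a b)" if "b \<in> A" "\<eta> > 0" for b \<eta>
    using lower[OF \<open>\<eta> > 0\<close>] above[OF \<open>b \<in> A\<close>] \<open>b \<in> A\<close> by (meson cSUP_upper order_trans)
  have bdd1: "bdd_above ((\<lambda>a. INF b\<in>A. E a b) ` A)"
    by (rule bdd_aboveI2[of _ _ "v + 1"]) (simp add: INF_le)
  have bdd2: "bdd_below ((\<lambda>b. SUP a\<in>A. E a b) ` A)"
    by (rule bdd_belowI2[of _ "v - 1"]) (simp add: le_SUP)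
  show "(SUP a\<in>A. INF b\<in>A. E a b) = v"
  proof (rule antisym)
    show "(SUP a\<in>A. INF b\<in>A. E a b) \<le> v"
      by (rule field_le_epsilon) (use INF_le ne in \<open>auto intro!: cSUP_least\<close>)
    show "v \<le> (SUP a\<in>A. INF b\<in>A. E a b)"
    proof (rule field_le_epsilon)
      fix \<eta> :: real assume "\<eta> > 0"
      then obtain a where a: "a \<in> A" "\<And>b. b \<in> A \<Longrightarrow> v - \<eta> \<le> E a b"
        using lower by blast
      have "v - \<eta> \<le> (INF b\<in>A. E a b)"
        using ne a(2) by (rule cINF_greatest)
      also have "\<dots> \<le> (SUP a\<in>A. INF b\<in>A. E a b)"
        using a(1) bdd1 by (rule cSUP_upper)
      finally show "v \<le> (SUP a\<in>A. INF b\<in>A. E a b) + \<eta>"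
        by simp
    qed
  qed
  show "(INF b\<in>A. SUP a\<in>A. E a b) = v"
  proof (rule antisym)
    show "(INF b\<in>A. SUP a\<in>A. E a b) \<le> v"
    proof (rule field_le_epsilon)
      fix \<eta> :: real assume "\<eta> > 0"
      then obtain b where b: "b \<in> A" "\<And>a. a \<in> A \<Longrightarrow> E a b \<le> v + \<eta>"
        using upper by blast
      have "(INF b\<in>A. SUP a\<in>A. E a b) \<le> (SUP a\<in>A. E a b)"
        using bdd2 b(1) by (rule cINF_lower)
      also have "\<dots> \<le> v + \<eta>"
        using ne b(2) by (rule cSUP_least)
      finally show "(INF b\<in>A. SUP a\<in>A. E a b) \<le> v + \<eta>" .
    qed
    show "v \<le> (INF b\<in>A. SUP a\<in>A. E a b)"
    proof (rule field_le_epsilon)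
      fix \<eta> :: real assume "\<eta> > 0"
      have "v - \<eta> \<le> (INF b\<in>A. SUP a\<in>A. E a b)"
        using ne le_SUP[OF _ \<open>\<eta> > 0\<close>] by (rule cINF_greatest)
      then show "v \<le> (INF b\<in>A. SUP a\<in>A. E a b) + \<eta>"
        by linarith
    qed
  qed
qed

theorem theorem4p1:
  fixes U :: "(real ^ 'm) set"
    and T \<epsilon> :: real
    and p :: ereal
    and F u :: "(real ^ 'm) \<times> (real ^ 'm) \<times> real \<Rightarrow> real"
  assumes "bounded_C2_domain U"
    and "0 < T"
    and "2 \<le> p"
    and "0 < \<epsilon>"
    and "F \<in> G_class U T \<epsilon>"
    and "kolmogorov_function U T p \<epsilon> F u"
  shows "\<forall>z \<in> U \<times> UNIV \<times> {0<..<T}.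
           value_I U T p \<epsilon> F z = u z \<and> u z = value_II U T p \<epsilon> F z"
proof -
  have "open U"
    using assms(1) by (simp add: bounded_C2_domain_def)
  interpret max: kolmogorov_game U T \<epsilon> p F u
    using \<open>open U\<close> assms by unfold_locales
  interpret min: kolmogorov_game U T \<epsilon> p "\<lambda>z. - F z" "\<lambda>z. - u z"
    using \<open>open U\<close> assms kolmogorov_function_uminus[OF assms(6)] by unfold_locales
  have "value_I U T p \<epsilon> F (X, Y, t) = u (X, Y, t) \<and> u (X, Y, t) = value_II U T p \<epsilon> F (X, Y, t)"
    if X: "X \<in> U" and t: "0 < t" "t < T" for X Y t
  proof -
    let ?E = "expected_payoff U T p \<epsilon> F X Y t"
    obtain B where B: "\<And>SI SII. SI \<in> strategies \<epsilon> \<Longrightarrow> SII \<in> strategies \<epsilon> \<Longrightarrow> \<bar>?E SI SII\<bar> \<le> B"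
      using max.expected_payoff_bounded by blast
    have lower: "\<exists>SI\<in>strategies \<epsilon>. \<forall>SII\<in>strategies \<epsilon>. u (X, Y, t) - \<eta> \<le> ?E SI SII" if "\<eta> > 0" for \<eta>
      by (rule max.near_optimal_expected_payoff[OF X t that])
    have upper: "\<exists>SII\<in>strategies \<epsilon>. \<forall>SI\<in>strategies \<epsilon>. ?E SI SII \<le> u (X, Y, t) + \<eta>" if "\<eta> > 0" for \<eta>
    proof -
      have "- u (X, Y, t) - \<eta> \<le> - e \<longleftrightarrow> e \<le> u (X, Y, t) + \<eta>" for e
        by linarith
      then show ?thesis
        using min.near_optimal_expected_payoff[OF X t that, of Y] by (simp only: expected_payoff_uminus)
    qed
    from saddle_point_value[of "strategies \<epsilon>" ?E, OF B lower upper]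
    show ?thesis
      by (simp add: value_I_def value_II_def)
  qed
  then show ?thesis
    by auto
qed

end
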